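(* Consider $\mathbb{R}^{n}$ as the abelian group $(\mathbb{R}^{n},+)$ with the standard isotropic dilations $x\mapsto\lambda x$. (i) For any homogeneous quasi-norm $|\cdot|$ on $\mathbb{R}^{n}$, any $R>0$ and every $f\in C_{0}^{\infty}(B(0,R)\setminus\{0\})$, $$\left\|\frac{f}{|x|}\right\|_{L^{n}(B(0,R))}\leq n\left\|(\log|x|)\,\frac{x}{|x|}\cdot\nabla f\right\|_{L^{n}(B(0,R))},$$ and the constant $n$ is optimal. (ii) If $|x|=\sqrt{x_{1}^{2}+\cdots+x_{n}^{2}}$ is the Euclidean norm, then for all $f\in C_{0}^{\infty}(\mathbb{R}^{n}\setminus\{0\})$, $$\left\|\frac{f}{|x|}\right\|_{L^{n}(\mathbb{R}^{n})}\leq n\left\|(\log|x|)\,\nabla f\right\|_{L^{n}(\mathbb{R}^{n})},$$ and the constant $n$ is optimal.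
   Context: A homogeneous quasi-norm on $\mathbb{R}^{n}$ (for the standard dilations) is a continuous function $|\cdot|:\mathbb{R}^{n}\to[0,\infty)$ with $|-x|=|x|$, $|\lambda x|=\lambda|x|$ for all $x$ and $\lambda>0$, and $|x|=0$ if and only if $x=0$. $B(0,R)=\{x\in\mathbb{R}^{n}:|x|<R\}$ is the quasi-ball for $|\cdot|$. $\nabla$ is the standard gradient in $\mathbb{R}^{n}$. $C_0^\infty(U)$ denotes complex-valued smooth functions with compact support in $U$. "Optimal" means that the constant cannot be replaced by a smaller constant valid for all such $f$. *)

theory Defs
  imports "HOL-Analysis.Analysis"
begin

definition homogeneous_quasinorm :: "(real ^ 'n \<Rightarrow> real) \<Rightarrow> bool" where
  "homogeneous_quasinorm q \<longleftrightarrow>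
     continuous_on UNIV q \<and>
     (\<forall>x. 0 \<le> q x) \<and>
     (\<forall>x. q (- x) = q x) \<and>
     (\<forall>x l. 0 < l \<longrightarrow> q (l *\<^sub>R x) = l * q x) \<and>
     (\<forall>x. q x = 0 \<longleftrightarrow> x = 0)"

definition quasi_ball :: "(real ^ 'n \<Rightarrow> real) \<Rightarrow> real \<Rightarrow> (real ^ 'n) set" where
  "quasi_ball q R = {x. q x < R}"

primrec continuously_differentiable ::
    "nat \<Rightarrow> ('a::real_normed_vector \<Rightarrow> 'b::real_normed_vector) \<Rightarrow> bool" where
  "continuously_differentiable 0 f \<longleftrightarrow> continuous_on UNIV f"
| "continuously_differentiable (Suc k) f \<longleftrightarrow>
     (\<forall>x. f differentiable (at x)) \<and>
     (\<forall>v. continuously_differentiable k (\<lambda>x. frechet_derivative f (at x) v))"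

definition smooth :: "('a::real_normed_vector \<Rightarrow> 'b::real_normed_vector) \<Rightarrow> bool" where
  "smooth f \<longleftrightarrow> (\<forall>k. continuously_differentiable k f)"

(* Elements of C_0^infinity(U), for U open, are identified with their extensions by zero
   to the whole space. *)
definition test_functions :: "(real ^ 'n) set \<Rightarrow> (real ^ 'n \<Rightarrow> complex) set" where
  "test_functions U =
     {f. smooth f \<and> compact (closure (support_on UNIV f)) \<and> closure (support_on UNIV f) \<subseteq> U}"

definition grad :: "(real ^ 'n \<Rightarrow> complex) \<Rightarrow> real ^ 'n \<Rightarrow> complex ^ 'n" where
  "grad f x = (\<chi> i. frechet_derivative f (at x) (axis i 1))"

(* The bilinear pairing v . w = v_1 w_1 + ... + v_n w_n of a real with a complex vector. *)
definition real_dot :: "real ^ 'n \<Rightarrow> complex ^ 'n \<Rightarrow> complex" where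
  "real_dot v w = (\<Sum>i\<in>UNIV. (v $ i) *\<^sub>R (w $ i))"

(* Extended-valued, so that a non-integrable function has norm infinity. Intended for
   0 < p < infinity. *)
definition Lp_norm :: "real \<Rightarrow> 'a::euclidean_space set \<Rightarrow> ('a \<Rightarrow> 'b::real_normed_vector) \<Rightarrow> ennreal" where
  "Lp_norm p A g =
     (let I = (\<integral>\<^sup>+x\<in>A. ennreal (norm (g x) powr p) \<partial>lborel)
      in if I = \<infinity> then \<infinity> else ennreal (enn2real I powr (1 / p)))"

end

(* The measure dx / q(x)^n is invariant under dilations. Hence, with F = |f|^n, differentiating the
   integral of F(e^d x) ln q(e^d x) against it at d = 0 gives
     int F / q^n = - int (x . grad F) ln q / q^n,
   and since |x . grad F| <= n |f|^(n-1) |x . grad f|, Young's inequality yields the estimate with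
   the constant n. Only difference quotients of F are used, so n = 1, where F is not differentiable,
   needs no special treatment.

   For optimality take f(x) = g(ln |x|) with the Euclidean norm |x|. By dilation invariance both
   sides become integrals over the line, up to a common factor and the bounded difference between
   ln q and ln |x|, which is negligible when g lives near minus infinity. With s = - ln |x| the
   choice g = s^(-1/n) b((ln s - ln T) / M) turns them into M int b^n and M int |b/n - b'/M|^n,
   whose quotient tends to n^n as M grows. *)
theory Submission
  imports Defs
begin

section \<open>Homogeneous weights\<close>

text \<open>The identity behind the inequality is exact for every finite dilation step d, because ln
  q(e^d x) = d + ln q(x); a limit is taken only in its upper bound. There the increment of |f|^n is
  estimated through |f(e^d x) - f(x)|, whose quotient by d converges even where |f| has a corner.
  Young's inequality leaves n - 1 copies of the left side on the right; they can be absorbed because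
  the left side is finite, f having compact support away from 0. For optimality, functions of q
  would be no smoother than q, which is merely continuous; hence the Euclidean norm. It also makes
  grad f parallel to x, so the same functions serve both parts. Polar coordinates are replaced by a
  Fubini argument for dilation-invariant measures: a function of ln |x| integrates to a constant
  times its integral over the line. The same argument for dt / |t| on the negative half-line
  provides the substitution u = ln s. The power s^(-1/n) is the borderline case: its n-th power and
  that of s times its derivative are multiples of 1 / s in ratio n^n, and just fail to be
  integrable.\<close>

lemma nn_integral_lborel_scaleR:
  fixes f :: "'a::euclidean_space \<Rightarrow> ennreal"
  assumes [measurable]: "f \<in> borel_measurable borel" and "0 < c"
  shows "(\<integral>\<^sup>+x. f x \<partial>lborel) = ennreal (c ^ DIM('a)) * (\<integral>\<^sup>+x. f (c *\<^sub>R x) \<partial>lborel)"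
  using assms(2) by (subst lborel_affine[of c 0])
    (simp_all add: nn_integral_density nn_integral_distr nn_integral_cmult)

lemma integral_lborel_scaleR:
  fixes f :: "'a::euclidean_space \<Rightarrow> real"
  assumes [measurable]: "f \<in> borel_measurable borel" and "0 < c"
  shows "(\<integral>x. f x \<partial>lborel) = c ^ DIM('a) * (\<integral>x. f (c *\<^sub>R x) \<partial>lborel)"
  using assms(2) by (subst lborel_affine[of c 0])
    (simp_all add: integral_density integral_distr)

text \<open>Homogeneity of degree minus the dimension, so that the measure with density
  \<open>w\<close> is invariant under dilations. The instances are 1 / q^n and, on the line, the
  weight in \<open>homogeneous_weight_halfline\<close>.\<close>

definition homogeneous_weight :: "('a::euclidean_space \<Rightarrow> real) \<Rightarrow> bool" where
  "homogeneous_weight w \<longleftrightarrow> w \<in> borel_measurable borel \<and> (\<forall>x. 0 \<le> w x) \<and>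
     (\<forall>x c. 0 < c \<longrightarrow> w (c *\<^sub>R x) = w x / c ^ DIM('a))"

lemma homogeneous_weight_measurable: "homogeneous_weight w \<Longrightarrow> w \<in> borel_measurable borel"
  by (simp add: homogeneous_weight_def)

text \<open>The origin is fixed by every dilation, which forces the value 0. Thus x = 0, where
  \<open>ln\<close> of a product does not split, drops out of all later integrals.\<close>

lemma homogeneous_weight_zero:
  assumes "homogeneous_weight (w :: 'a::euclidean_space \<Rightarrow> real)" shows "w 0 = 0"
proof -
  have "w (2 *\<^sub>R 0) = w 0 / 2 ^ DIM('a)"
    using assms unfolding homogeneous_weight_def by (metis zero_less_numeral)
  moreover have "(1::real) < 2 ^ DIM('a)" by (rule one_less_power) auto
  ultimately show ?thesis by (auto simp: field_simps)
qed

text \<open>The Jacobian of the substitution cancels the factor that the weight acquires.\<close>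

lemma nn_integral_weight_dilation:
  fixes H :: "'a::euclidean_space \<Rightarrow> ennreal"
  assumes w: "homogeneous_weight w" and [measurable]: "H \<in> borel_measurable borel" and c: "0 < c"
  shows "(\<integral>\<^sup>+x. H (c *\<^sub>R x) * ennreal (w x) \<partial>lborel) = (\<integral>\<^sup>+x. H x * ennreal (w x) \<partial>lborel)"
proof -
  note [measurable] = homogeneous_weight_measurable[OF w]
  have *: "ennreal (c ^ DIM('a)) * ennreal (w (c *\<^sub>R x)) = ennreal (w x)" for x
    using w c by (simp add: homogeneous_weight_def flip: ennreal_mult)
  have "(\<integral>\<^sup>+x. H x * ennreal (w x) \<partial>lborel)
      = (\<integral>\<^sup>+x. ennreal (c ^ DIM('a)) * (H (c *\<^sub>R x) * ennreal (w (c *\<^sub>R x))) \<partial>lborel)"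
    by (subst nn_integral_lborel_scaleR[OF _ c]) (auto simp: nn_integral_cmult)
  also have "\<dots> = (\<integral>\<^sup>+x. H (c *\<^sub>R x) * ennreal (w x) \<partial>lborel)"
    by (subst mult.left_commute) (simp add: *)
  finally show ?thesis by simp
qed

lemma integral_weight_dilation:
  fixes H :: "'a::euclidean_space \<Rightarrow> real"
  assumes w: "homogeneous_weight w" and [measurable]: "H \<in> borel_measurable borel" and c: "0 < c"
  shows "(\<integral>x. H (c *\<^sub>R x) * w x \<partial>lborel) = (\<integral>x. H x * w x \<partial>lborel)"
proof -
  note [measurable] = homogeneous_weight_measurable[OF w]
  have "(\<integral>x. H x * w x \<partial>lborel) = (\<integral>x. c ^ DIM('a) * (H (c *\<^sub>R x) * w (c *\<^sub>R x)) \<partial>lborel)"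
    by (subst integral_lborel_scaleR[OF _ c]) auto
  also have "\<dots> = (\<integral>x. H (c *\<^sub>R x) * w x \<partial>lborel)"
    using w c by (intro Bochner_Integration.integral_cong) (auto simp: homogeneous_weight_def)
  finally show ?thesis by simp
qed

text \<open>The double integral \<open>?D\<close> of h(y) against a window of mass 1 at y - ln |x|
  is computed in both orders. Shifting y by ln |x| and using dilation invariance gives the left
  side; integrating over x first gives h(y) times a constant independent of y, again by
  invariance.\<close>

lemma nn_integral_radial:
  fixes w :: "'a::euclidean_space \<Rightarrow> real" and h :: "real \<Rightarrow> ennreal"
  assumes w: "homogeneous_weight w" and [measurable]: "h \<in> borel_measurable borel"
  shows "(\<integral>\<^sup>+x. h (ln (norm x)) * ennreal (w x) \<partial>lborel)
    = (\<integral>\<^sup>+x. indicator {0..1} (- ln (norm x)) * ennreal (w x) \<partial>lborel) * (\<integral>\<^sup>+t. h t \<partial>lborel)"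
    (is "?I = ?c * _")
proof -
  note [measurable] = homogeneous_weight_measurable[OF w]
  let ?W = "\<lambda>x. ennreal (w x)"
  let ?g = "indicator {0..1} :: real \<Rightarrow> ennreal"
  \<comment> \<open>Multiplying x by e^z shifts ln |x| by z.\<close>
  have dil: "(\<integral>\<^sup>+x. H (z + ln (norm x)) * ?W x \<partial>lborel) = (\<integral>\<^sup>+x. H (ln (norm x)) * ?W x \<partial>lborel)"
    if [measurable]: "H \<in> borel_measurable borel" for H :: "real \<Rightarrow> ennreal" and z
  proof -
    have "(\<integral>\<^sup>+x. H (z + ln (norm x)) * ?W x \<partial>lborel) = (\<integral>\<^sup>+x. H (ln (norm (exp z *\<^sub>R x))) * ?W x \<partial>lborel)"
    proof (rule nn_integral_cong)
      fix x :: 'a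
      show "H (z + ln (norm x)) * ?W x = H (ln (norm (exp z *\<^sub>R x))) * ?W x"
        by (cases "x = 0") (auto simp: homogeneous_weight_zero[OF w] ln_mult)
    qed
    also have "\<dots> = (\<integral>\<^sup>+x. H (ln (norm x)) * ?W x \<partial>lborel)"
      by (rule nn_integral_weight_dilation[OF w]) auto
    finally show ?thesis .
  qed
  let ?D = "\<integral>\<^sup>+x. (\<integral>\<^sup>+y. h y * ?g (y - ln (norm x)) * ?W x \<partial>lborel) \<partial>lborel"
  have "?D = (\<integral>\<^sup>+x. (\<integral>\<^sup>+z. h (z + ln (norm x)) * ?g z * ?W x \<partial>lborel) \<partial>(lborel::'a measure))"
  proof (rule nn_integral_cong)
    fix x :: 'a
    show "(\<integral>\<^sup>+y. h y * ?g (y - ln (norm x)) * ?W x \<partial>lborel)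
      = (\<integral>\<^sup>+z. h (z + ln (norm x)) * ?g z * ?W x \<partial>lborel)"
      by (subst nn_integral_real_affine[of _ 1 "ln (norm x)"]) (auto simp: add.commute)
  qed
  also have "\<dots> = (\<integral>\<^sup>+z. (\<integral>\<^sup>+x. h (z + ln (norm x)) * ?g z * ?W x \<partial>(lborel::'a measure)) \<partial>lborel)"
    by (rule lborel_pair.Fubini') measurable
  also have "\<dots> = (\<integral>\<^sup>+z. ?g z * ?I \<partial>lborel)"
  proof (rule nn_integral_cong)
    fix z :: real
    have "(\<integral>\<^sup>+x. h (z + ln (norm x)) * ?g z * ?W x \<partial>(lborel::'a measure))
      = ?g z * (\<integral>\<^sup>+x. h (z + ln (norm x)) * ?W x \<partial>lborel)"
      by (subst nn_integral_cmult[symmetric]) (auto simp: mult_ac)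
    then show "(\<integral>\<^sup>+x. h (z + ln (norm x)) * ?g z * ?W x \<partial>(lborel::'a measure)) = ?g z * ?I"
      by (simp add: dil)
  qed
  \<comment> \<open>The window has mass 1.\<close>
  also have "\<dots> = ?I"
    by (subst nn_integral_multc) auto
  finally have 1: "?D = ?I" .
  have "?D = (\<integral>\<^sup>+y. (\<integral>\<^sup>+x. h y * ?g (y - ln (norm x)) * ?W x \<partial>(lborel::'a measure)) \<partial>lborel)"
    by (rule lborel_pair.Fubini') measurable
  also have "\<dots> = (\<integral>\<^sup>+y. h y * ?c \<partial>lborel)"
  proof (rule nn_integral_cong)
    fix y :: real
    have "(\<integral>\<^sup>+x. h y * ?g (y - ln (norm x)) * ?W x \<partial>(lborel::'a measure))
      = h y * (\<integral>\<^sup>+x. ?g (y - ln (norm x)) * ?W x \<partial>lborel)"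
      by (subst nn_integral_cmult[symmetric]) (auto simp: mult_ac)
    also have "(\<integral>\<^sup>+x. ?g (y - ln (norm x)) * ?W x \<partial>lborel) = ?c"
      using dil[of "\<lambda>t. ?g (- t)" "- y"] by simp
    finally show "(\<integral>\<^sup>+x. h y * ?g (y - ln (norm x)) * ?W x \<partial>(lborel::'a measure)) = h y * ?c" .
  qed
  also have "\<dots> = ?c * (\<integral>\<^sup>+t. h t \<partial>lborel)"
    by (subst nn_integral_multc) (auto simp: mult_ac)
  finally show ?thesis using 1 by simp
qed

section \<open>Smooth functions\<close>

text \<open>Order 0 carries no condition, not even continuity; k counts the derivatives that exist
  on S. The set is a parameter so that expressions with \<open>ln\<close> and \<open>powr\<close>
  can be treated on a half-line and glued afterwards.\<close>

primrec smooth_upto :: "nat \<Rightarrow> real set \<Rightarrow> (real \<Rightarrow> real) \<Rightarrow> bool" where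
  "smooth_upto 0 S f \<longleftrightarrow> True"
| "smooth_upto (Suc k) S f \<longleftrightarrow> (\<forall>x\<in>S. f field_differentiable (at x)) \<and> smooth_upto k S (deriv f)"

lemma deriv_cong_open:
  assumes "open S" "x \<in> S" "\<And>y. y \<in> S \<Longrightarrow> f y = g y"
  shows "deriv f x = deriv g x"
  using assms by (intro deriv_cong_ev eventually_nhds_in_open[THEN eventually_mono]) auto

lemma field_differentiable_cong_open:
  assumes "open S" "x \<in> S" "\<And>y. y \<in> S \<Longrightarrow> f y = g y" "g field_differentiable (at x)"
  shows "f field_differentiable (at x)"
  using assms unfolding field_differentiable_def
  by (metis has_field_derivative_transform_within_open)

lemma smooth_upto_cong:
  assumes "open S" "\<And>y. y \<in> S \<Longrightarrow> f y = g y" "smooth_upto k S g"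
  shows "smooth_upto k S f"
  using assms(2,3)
proof (induction k arbitrary: f g)
  case (Suc k)
  have "smooth_upto k S (deriv f)"
  proof (rule Suc.IH)
    show "deriv f y = deriv g y" if "y \<in> S" for y
      using deriv_cong_open[OF assms(1) that Suc.prems(1)] .
    show "smooth_upto k S (deriv g)"
      using Suc.prems(2) by simp
  qed
  moreover have "\<forall>x\<in>S. f field_differentiable (at x)"
    using field_differentiable_cong_open[OF assms(1) _ Suc.prems(1)] Suc.prems(2) by auto
  ultimately show ?case by simp
qed auto

lemma smooth_upto_Un: "smooth_upto k (S \<union> T) f \<longleftrightarrow> smooth_upto k S f \<and> smooth_upto k T f"
  by (induction k arbitrary: f) auto

lemma smooth_upto_SucI:
  assumes "open S" "\<And>x. x \<in> S \<Longrightarrow> (f has_field_derivative f' x) (at x)" "smooth_upto k S f'"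
  shows "smooth_upto (Suc k) S f"
  using assms smooth_upto_cong[OF assms(1), of "deriv f" f' k]
  by (auto simp: field_differentiable_def DERIV_imp_deriv)

lemma smooth_upto_Suc: "smooth_upto (Suc k) S f \<Longrightarrow> smooth_upto k S f"
proof (induction k arbitrary: f)
  case (Suc k)
  then show ?case using Suc.IH[of "deriv f"] by (simp only: smooth_upto.simps(2)) blast
qed simp

lemma smooth_upto_DERIV:
  "smooth_upto (Suc k) S f \<Longrightarrow> x \<in> S \<Longrightarrow> (f has_field_derivative deriv f x) (at x)"
  by (simp add: field_differentiable_derivI)

lemma smooth_upto_const: "open S \<Longrightarrow> smooth_upto k S (\<lambda>x. c)"
proof (induction k arbitrary: c)
  case (Suc k)
  then show ?case by (intro smooth_upto_SucI[where f' = "\<lambda>x. 0"]) auto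
qed auto

lemma smooth_upto_ident: "open S \<Longrightarrow> smooth_upto k S (\<lambda>x. x)"
proof (induction k)
  case (Suc k)
  then show ?case by (intro smooth_upto_SucI[where f' = "\<lambda>x. 1"] smooth_upto_const) auto
qed auto

lemma smooth_upto_add:
  assumes "open S"
  shows "smooth_upto k S f \<Longrightarrow> smooth_upto k S g \<Longrightarrow> smooth_upto k S (\<lambda>x. f x + g x)"
proof (induction k arbitrary: f g)
  case (Suc k)
  show ?case
  proof (rule smooth_upto_SucI[OF assms])
    show "((\<lambda>x. f x + g x) has_field_derivative deriv f x + deriv g x) (at x)" if "x \<in> S" for x
      by (rule DERIV_add[OF smooth_upto_DERIV smooth_upto_DERIV]) (rule Suc.prems that)+
    show "smooth_upto k S (\<lambda>x. deriv f x + deriv g x)"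
      using Suc by simp
  qed
qed auto

lemma smooth_upto_mult:
  assumes "open S"
  shows "smooth_upto k S f \<Longrightarrow> smooth_upto k S g \<Longrightarrow> smooth_upto k S (\<lambda>x. f x * g x)"
proof (induction k arbitrary: f g)
  case (Suc k)
  show ?case
  proof (rule smooth_upto_SucI[OF assms])
    show "((\<lambda>x. f x * g x) has_field_derivative deriv f x * g x + deriv g x * f x) (at x)"
      if "x \<in> S" for x
      by (rule DERIV_mult[OF smooth_upto_DERIV smooth_upto_DERIV]) (rule Suc.prems that)+
    show "smooth_upto k S (\<lambda>x. deriv f x * g x + deriv g x * f x)"
      by (rule smooth_upto_add[OF assms Suc.IH Suc.IH])
        (use Suc.prems smooth_upto_Suc in auto)
  qed
qed auto

lemma smooth_upto_compose:
  assumes "open S" "\<And>x. x \<in> S \<Longrightarrow> g x \<in> T"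
  shows "smooth_upto k T f \<Longrightarrow> smooth_upto k S g \<Longrightarrow> smooth_upto k S (\<lambda>x. f (g x))"
proof (induction k arbitrary: f)
  case (Suc k)
  show ?case
  proof (rule smooth_upto_SucI[OF assms(1)])
    show "((\<lambda>x. f (g x)) has_field_derivative deriv f (g x) * deriv g x) (at x)"
      if "x \<in> S" for x
      by (rule DERIV_chain2[OF smooth_upto_DERIV smooth_upto_DERIV])
        (rule Suc.prems that assms(2))+
    show "smooth_upto k S (\<lambda>x. deriv f (g x) * deriv g x)"
      by (rule smooth_upto_mult[OF assms(1) Suc.IH]) (use Suc.prems smooth_upto_Suc in auto)
  qed
qed auto

lemma smooth_upto_powr: "smooth_upto k {0<..} (\<lambda>x. x powr a)"
proof (induction k arbitrary: a)
  case (Suc k)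
  show ?case
    by (intro smooth_upto_SucI[where f' = "\<lambda>x. a * x powr (a - 1)"] smooth_upto_mult
        smooth_upto_const Suc has_real_derivative_powr) auto
qed auto

lemma smooth_upto_ln: "smooth_upto k {0<..} ln"
proof (cases k)
  case (Suc j)
  show ?thesis unfolding Suc
  proof (intro smooth_upto_SucI[where f' = "\<lambda>x. x powr (-1)"] smooth_upto_powr)
    fix x :: real assume "x \<in> {0<..}"
    then show "(ln has_field_derivative x powr (-1)) (at x)"
      by (auto intro!: derivative_eq_intros simp: powr_minus_divide)
  qed auto
qed auto

text \<open>The classical flat function with an extra inverse power. Derivatives of members of this
  family are linear combinations of members, which makes smoothness a plain induction over all m at
  once.\<close>

definition flat_exp :: "nat \<Rightarrow> real \<Rightarrow> real" where
  "flat_exp m x = (if 0 < x then inverse x ^ m * exp (- inverse x) else 0)"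

lemma flat_exp_tendsto_0: "(flat_exp m \<longlongrightarrow> 0) (at 0)"
proof -
  have "((\<lambda>x::real. inverse x ^ m * exp (- inverse x)) \<longlongrightarrow> 0) (at_right 0)"
  proof -
    have "((\<lambda>y::real. y ^ m / exp y) \<longlongrightarrow> 0) at_top"
      by (rule tendsto_power_div_exp_0)
    from filterlim_compose[OF this filterlim_inverse_at_top_right]
    show ?thesis by (simp add: exp_minus divide_inverse)
  qed
  then have "(flat_exp m \<longlongrightarrow> 0) (at_right 0)"
    by (rule Lim_transform_eventually)
       (auto simp: flat_exp_def eventually_at_filter)
  moreover have "(flat_exp m \<longlongrightarrow> 0) (at_left 0)"
    by (rule tendsto_eventually) (auto simp: flat_exp_def eventually_at_filter)
  ultimately show ?thesis by (simp add: filterlim_at_split)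
qed

lemma flat_exp_DERIV:
  "(flat_exp m has_field_derivative (flat_exp (m + 2) x - of_nat m * flat_exp (m + 1) x)) (at x)"
proof -
  consider "0 < x" | "x < 0" | "x = 0" by linarith
  then show ?thesis
  proof cases
    case 1
    have "((\<lambda>x. inverse x ^ m * exp (- inverse x)) has_field_derivative
        (flat_exp (m + 2) x - of_nat m * flat_exp (m + 1) x)) (at x)"
    proof -
      have i: "(inverse has_field_derivative - (inverse x * inverse x)) (at x)"
        using DERIV_inverse[of x] 1 by (simp add: power2_eq_square)
      have "((\<lambda>x. inverse x ^ m) has_field_derivative - of_nat m * inverse x ^ (m + 1)) (at x)"
        using DERIV_power[OF i, of m] by (cases m) (simp_all add: algebra_simps)
      moreover have "((\<lambda>x. exp (- inverse x)) has_field_derivative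
          exp (- inverse x) * (inverse x * inverse x)) (at x)"
        using DERIV_fun_exp[OF DERIV_minus[OF i]] by simp
      ultimately have "((\<lambda>x. inverse x ^ m * exp (- inverse x)) has_field_derivative
          - of_nat m * inverse x ^ (m + 1) * exp (- inverse x)
          + exp (- inverse x) * (inverse x * inverse x) * inverse x ^ m) (at x)"
        by (rule DERIV_mult)
      then show ?thesis
        using 1 by (simp add: flat_exp_def algebra_simps)
    qed
    then show ?thesis
      by (rule has_field_derivative_transform_within_open[of _ _ _ "{0<..}"])
         (use 1 in \<open>auto simp: flat_exp_def\<close>)
  next
    case 2
    have "((\<lambda>x. 0) has_field_derivative
        (flat_exp (m + 2) x - of_nat m * flat_exp (m + 1) x)) (at x)"
      using 2 by (auto simp: flat_exp_def)
    then show ?thesis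
      by (rule has_field_derivative_transform_within_open[of _ _ _ "{..<0}"])
         (use 2 in \<open>auto simp: flat_exp_def\<close>)
  next
    case 3
    \<comment> \<open>At 0 the difference quotient is itself a flat function, with one more inverse
      power.\<close>
    have "((\<lambda>y. (flat_exp m y - flat_exp m 0) / (y - 0)) \<longlongrightarrow> 0) (at 0)"
      by (rule Lim_transform_eventually[OF flat_exp_tendsto_0[of "Suc m"]])
         (auto simp: flat_exp_def eventually_at_filter field_simps)
    then show ?thesis
      using 3 by (simp add: has_field_derivative_iff flat_exp_def)
  qed
qed

lemma smooth_upto_flat_exp: "smooth_upto k UNIV (flat_exp m)"
proof (induction k arbitrary: m)
  case (Suc k)
  have "smooth_upto k UNIV (\<lambda>x. flat_exp (m + 2) x + (- of_nat m) * flat_exp (m + 1) x)"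
    by (intro smooth_upto_add smooth_upto_mult smooth_upto_const Suc) auto
  then show ?case
    using flat_exp_DERIV[of m] by (intro smooth_upto_SucI) auto
qed auto

text \<open>A function flat at 0 times its mirror image at 1. Off the closed interval b vanishes in
  a whole neighbourhood, hence so does its derivative.\<close>

lemma exists_smooth_bump:
  obtains b :: "real \<Rightarrow> real"
  where "\<And>k. smooth_upto k UNIV b" "\<And>x. 0 \<le> b x" "\<And>x. 0 < b x \<longleftrightarrow> 0 < x \<and> x < 1"
    "\<And>x. x \<notin> {0..1} \<Longrightarrow> deriv b x = 0"
proof
  define b where "b x = flat_exp 0 x * flat_exp 0 (1 - x)" for x
  have "smooth_upto k UNIV (\<lambda>x. 1 + (-1) * x)" for k
    by (rule smooth_upto_add[OF open_UNIV smooth_upto_const[OF open_UNIV]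
        smooth_upto_mult[OF open_UNIV smooth_upto_const[OF open_UNIV] smooth_upto_ident[OF open_UNIV]]])
  from smooth_upto_compose[OF open_UNIV UNIV_I smooth_upto_flat_exp this]
  have "smooth_upto k UNIV (\<lambda>x. flat_exp 0 (1 - x))" for k
    by simp
  then show "smooth_upto k UNIV b" for k
    unfolding b_def by (rule smooth_upto_mult[OF open_UNIV smooth_upto_flat_exp])
  show "0 \<le> b x" for x by (auto simp: b_def flat_exp_def)
  show "0 < b x \<longleftrightarrow> 0 < x \<and> x < 1" for x by (auto simp: b_def flat_exp_def)
  show "deriv b x = 0" if "x \<notin> {0..1}" for x
  proof -
    have "deriv b x = deriv (\<lambda>_. 0) x"
      by (rule deriv_cong_open[of "- {0..1}"])
        (use that in \<open>auto simp: b_def flat_exp_def open_Compl\<close>)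
    then show ?thesis by simp
  qed
qed

section \<open>Closure properties of \<open>continuously_differentiable\<close>, and radial
  functions\<close>

lemma continuously_differentiable_Suc:
  "continuously_differentiable (Suc k) f \<Longrightarrow> continuously_differentiable k f"
proof (induction k arbitrary: f)
  case 0
  then show ?case
    by (auto intro!: differentiable_imp_continuous_on simp: differentiable_on_def
        differentiable_at_withinI)
next
  case (Suc k)
  have "continuously_differentiable k (\<lambda>x. frechet_derivative f (at x) v)" for v
    using Suc.prems by (intro Suc.IH) simp
  then show ?case using Suc.prems by simp
qed

lemma continuously_differentiable_SucI:
  assumes "\<And>x. (f has_derivative f' x) (at x)"
    "\<And>v. continuously_differentiable k (\<lambda>x. f' x v)"
  shows "continuously_differentiable (Suc k) f"
proof -
  have "frechet_derivative f (at x) = f' x" for x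
    using frechet_derivative_at[OF assms(1)] by simp
  then show ?thesis using assms by (auto simp: differentiable_def)
qed

lemma continuously_differentiable_has_derivative:
  "continuously_differentiable (Suc k) f \<Longrightarrow> (f has_derivative frechet_derivative f (at x)) (at x)"
  by (simp add: frechet_derivative_works)

lemma continuously_differentiable_const: "continuously_differentiable k (\<lambda>x. c)"
proof (induction k arbitrary: c)
  case (Suc k)
  show ?case by (rule continuously_differentiable_SucI[OF has_derivative_const Suc])
qed simp

lemma continuously_differentiable_bounded_linear:
  assumes "bounded_linear f" shows "continuously_differentiable k f"
proof (cases k)
  case 0
  then show ?thesis using assms by (simp add: linear_continuous_on)
next
  case (Suc j)
  show ?thesis unfolding Suc
    by (rule continuously_differentiable_SucI[OF bounded_linear_imp_has_derivative[OF assms]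
        continuously_differentiable_const])
qed

lemma continuously_differentiable_add:
  "continuously_differentiable k f \<Longrightarrow> continuously_differentiable k g
    \<Longrightarrow> continuously_differentiable k (\<lambda>x. f x + g x)"
proof (induction k arbitrary: f g)
  case 0
  then show ?case by (simp add: continuous_on_add)
next
  case (Suc k)
  show ?case
  proof (rule continuously_differentiable_SucI)
    show "((\<lambda>x. f x + g x) has_derivative
        (\<lambda>v. frechet_derivative f (at x) v + frechet_derivative g (at x) v)) (at x)" for x
      by (rule has_derivative_add) (rule continuously_differentiable_has_derivative Suc.prems)+
    show "continuously_differentiable k
        (\<lambda>x. frechet_derivative f (at x) v + frechet_derivative g (at x) v)" for v
      using Suc.prems by (intro Suc.IH) simp_all
  qed
qed

lemma continuously_differentiable_mult:
  fixes f g :: "'a::real_normed_vector \<Rightarrow> 'b::real_normed_algebra"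
  shows "continuously_differentiable k f \<Longrightarrow> continuously_differentiable k g
    \<Longrightarrow> continuously_differentiable k (\<lambda>x. f x * g x)"
proof (induction k arbitrary: f g)
  case 0
  then show ?case by (simp add: continuous_on_mult)
next
  case (Suc k)
  show ?case
  proof (rule continuously_differentiable_SucI)
    show "((\<lambda>x. f x * g x) has_derivative
        (\<lambda>v. f x * frechet_derivative g (at x) v + frechet_derivative f (at x) v * g x)) (at x)" for x
      by (rule has_derivative_mult) (rule continuously_differentiable_has_derivative Suc.prems)+
    show "continuously_differentiable k
        (\<lambda>x. f x * frechet_derivative g (at x) v + frechet_derivative f (at x) v * g x)" for v
      using Suc.prems Suc.prems[THEN continuously_differentiable_Suc]
      by (intro continuously_differentiable_add Suc.IH) simp_all
  qed
qed

text \<open>Radial functions are written through the squared norm, which is smooth at 0 where the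
  norm is not.\<close>

lemma has_derivative_real_of_inner_self:
  fixes x :: "'a::real_inner"
  assumes "(G has_field_derivative d) (at (x \<bullet> x))"
  shows "((\<lambda>x. G (x \<bullet> x)) has_derivative (\<lambda>v. d * (2 * (x \<bullet> v)))) (at x)"
proof -
  have "((\<lambda>x. x \<bullet> x) has_derivative (\<lambda>v. 2 * (x \<bullet> v))) (at x)"
    by (auto intro!: derivative_eq_intros simp: inner_commute)
  from has_derivative_compose[OF this, of G "\<lambda>v. d * v"] assms show ?thesis
    by (simp add: has_field_derivative_def)
qed

text \<open>One order is spent because \<open>smooth_upto\<close> does not assert continuity of the
  last derivative. The derivative in direction v is a radial function of the same kind times a
  linear function of x, which drives the induction.\<close>

lemma continuously_differentiable_radial:
  fixes G :: "real \<Rightarrow> real"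
  assumes "smooth_upto (Suc k) UNIV G"
  shows "continuously_differentiable k (\<lambda>x::'a::real_inner. of_real (G (x \<bullet> x)) :: complex)"
  using assms
proof (induction k arbitrary: G)
  case 0
  have "continuous_on UNIV G"
    using smooth_upto_DERIV[OF 0] by (auto intro!: continuous_at_imp_continuous_on DERIV_isCont)
  then have "continuous_on UNIV (\<lambda>x::'a. G (x \<bullet> x))"
    by (auto intro!: continuous_intros continuous_on_compose2[of UNIV G])
  then show ?case by (simp add: continuous_on_of_real)
next
  case (Suc k)
  show ?case
  proof (rule continuously_differentiable_SucI)
    fix x :: 'a
    show "((\<lambda>x::'a. of_real (G (x \<bullet> x)) :: complex) has_derivative
        (\<lambda>v. of_real (deriv G (x \<bullet> x)) * of_real (2 * (x \<bullet> v)))) (at x)"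
      using has_derivative_of_real[OF has_derivative_real_of_inner_self[OF smooth_upto_DERIV[OF Suc.prems UNIV_I]]]
      by simp
  next
    fix v :: 'a
    have "bounded_linear (\<lambda>x. of_real (2 * (x \<bullet> v)) :: complex)"
      by (intro bounded_linear_compose[OF bounded_linear_of_real]
          bounded_linear_const_mult bounded_linear_inner_left)
    then show "continuously_differentiable k
        (\<lambda>x. of_real (deriv G (x \<bullet> x)) * of_real (2 * (x \<bullet> v)) :: complex)"
      using Suc.prems
      by (intro continuously_differentiable_mult continuously_differentiable_bounded_linear Suc.IH) simp_all
  qed
qed

section \<open>The weighted Hardy inequality\<close>

text \<open>Bernoulli's inequality for y / a, multiplied by a^N. This is Young's inequality with
  exponents N / (N - 1) and N, in a form that covers N = 1, where a^0 = 1 also for a = 0.\<close>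

lemma young_power:
  fixes a y :: real
  assumes "0 \<le> a" "0 \<le> y" "0 < N"
  shows "real N * a ^ (N - 1) * y \<le> (real N - 1) * a ^ N + y ^ N"
proof (cases "a = 0")
  case True
  then show ?thesis using assms by (cases "N = 1") (auto simp: power_0_left)
next
  case False
  then have a: "0 < a" using assms by simp
  have "1 + real N * (y / a - 1) \<le> (1 + (y / a - 1)) ^ N"
    by (rule Bernoulli_inequality) (use assms a in auto)
  then have "(1 + real N * (y / a - 1)) * a ^ N \<le> (y / a) ^ N * a ^ N"
    using a by (intro mult_right_mono) auto
  also have "(y / a) ^ N * a ^ N = y ^ N"
    using a by (simp add: power_divide)
  also have "(1 + real N * (y / a - 1)) * a ^ N = real N * a ^ (N - 1) * y - (real N - 1) * a ^ N"
    using a assms(3) by (cases N) (auto simp: field_simps)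
  finally show ?thesis by linarith
qed

text \<open>The factorisation of a^N - b^N, each of its N terms being bounded by a power of the
  maximum. It replaces the chain rule for |f|^N.\<close>

lemma abs_diff_power_le:
  fixes a b :: real
  assumes "0 \<le> a" "0 \<le> b"
  shows "\<bar>a ^ N - b ^ N\<bar> \<le> real N * max a b ^ (N - 1) * \<bar>a - b\<bar>"
proof (cases "N = 0")
  case False
  let ?m = "max a b"
  have "\<bar>a ^ N - b ^ N\<bar> = \<bar>a - b\<bar> * \<bar>\<Sum>i<N. b ^ (N - Suc i) * a ^ i\<bar>"
    by (simp add: power_diff_sumr2 abs_mult)
  also have "\<bar>a - b\<bar> * \<bar>\<Sum>i<N. b ^ (N - Suc i) * a ^ i\<bar> \<le> \<bar>a - b\<bar> * (\<Sum>i<N. ?m ^ (N - 1))"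
  proof (rule mult_left_mono[OF order_trans[OF sum_abs sum_mono] abs_ge_zero])
    fix i assume "i \<in> {..<N}"
    then have "?m ^ (N - 1) = ?m ^ (N - Suc i) * ?m ^ i"
      by (simp flip: power_add)
    moreover have "b ^ (N - Suc i) * a ^ i \<le> ?m ^ (N - Suc i) * ?m ^ i"
      using assms by (intro mult_mono power_mono) auto
    ultimately show "\<bar>b ^ (N - Suc i) * a ^ i\<bar> \<le> ?m ^ (N - 1)"
      using assms by simp
  qed
  finally show ?thesis
    by (simp add: mult_ac)
qed simp

lemma exp_minus_one_le:
  fixes d :: real
  assumes "0 \<le> d" "d \<le> 1" shows "exp d - 1 \<le> d * exp 1"
proof -
  have "exp d * (1 - d) \<le> exp d * exp (- d)"
    using exp_ge_add_one_self[of "- d"] by (intro mult_left_mono) auto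
  then have "exp d - 1 \<le> d * exp d" by (simp add: exp_minus algebra_simps)
  also have "\<dots> \<le> d * exp 1" using assms by (intro mult_left_mono) auto
  finally show ?thesis .
qed

text \<open>Continuity is asked for on K alone because H will contain ln q and 1 / q^n, which are
  singular at the origin.\<close>

lemma integrable_continuous_compact_support:
  fixes H :: "'a::euclidean_space \<Rightarrow> real"
  assumes "compact K" "continuous_on K H" "\<And>x. x \<notin> K \<Longrightarrow> H x = 0"
  shows "integrable lborel H"
proof -
  have "(\<lambda>x. indicator K x *\<^sub>R H x) = H"
    by (intro ext) (use assms(3) in \<open>auto simp: indicator_def\<close>)
  then show ?thesis using borel_integrable_compact[OF assms(1,2)] by simp
qed

lemma homogeneous_weight_inverse_power:
  fixes q :: "'a::euclidean_space \<Rightarrow> real"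
  assumes "continuous_on UNIV q" "\<And>x. 0 \<le> q x" "\<And>x l. 0 < l \<Longrightarrow> q (l *\<^sub>R x) = l * q x"
  shows "homogeneous_weight (\<lambda>x. 1 / q x ^ DIM('a))"
proof -
  have [measurable]: "q \<in> borel_measurable borel"
    using assms(1) by (rule borel_measurable_continuous_onI)
  show ?thesis
    using assms(2,3) by (auto simp: homogeneous_weight_def power_mult_distrib field_simps)
qed

lemma tendsto_difference_quotient:
  fixes g :: "real \<Rightarrow> 'b::real_normed_vector"
  assumes "(g has_derivative (\<lambda>s. s *\<^sub>R d)) (at 0)"
  shows "((\<lambda>s. (g s - g 0) /\<^sub>R s) \<longlongrightarrow> d) (at 0)"
proof (rule LIM_zero_cancel, rule tendsto_norm_zero_cancel, rule Lim_transform_eventually)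
  show "((\<lambda>s. norm (g (0 + s) - g 0 - s *\<^sub>R d) / norm s) \<longlongrightarrow> 0) (at 0)"
    using assms unfolding has_derivative_at by blast
  have "norm (g s - g 0 - s *\<^sub>R d) / norm s = norm ((g s - g 0) /\<^sub>R s - d)" if "s \<noteq> 0" for s
  proof -
    have "g s - g 0 - s *\<^sub>R d = s *\<^sub>R ((g s - g 0) /\<^sub>R s - d)"
      using that by (simp add: scaleR_diff_right)
    then show ?thesis using that by simp
  qed
  then show "\<forall>\<^sub>F s in at 0. norm (g (0 + s) - g 0 - s *\<^sub>R d) / norm s = norm ((g s - g 0) /\<^sub>R s - d)"
    by (auto simp: eventually_at_filter)
qed

text \<open>Dilation by e^s with s in [0, 1] pulls the support inwards by at most a factor e. One
  compact shell away from 0 therefore carries all the functions x -> f(e^s x).\<close>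

lemma zero_outside_annulus_dilation:
  fixes f :: "'a::real_normed_vector \<Rightarrow> 'b::zero"
  assumes "0 < r1" "\<And>x. norm x \<notin> {r1..r2} \<Longrightarrow> f x = 0"
    and x: "x \<notin> cball 0 r2 - ball 0 (r1 / exp 1)" and "0 \<le> s" "s \<le> 1"
  shows "f (exp s *\<^sub>R x) = 0"
proof (rule assms(2))
  have "exp s * norm x < r1" if "norm x < r1 / exp 1"
  proof -
    have "exp s * norm x \<le> exp 1 * norm x"
      using \<open>s \<le> 1\<close> by (intro mult_right_mono) auto
    also have "\<dots> < r1" using that by (simp add: field_simps)
    finally show ?thesis .
  qed
  moreover have "r2 < exp s * norm x" if "r2 < norm x"
  proof -
    have "1 * norm x \<le> exp s * norm x"
      using \<open>0 \<le> s\<close> by (intro mult_right_mono) auto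
    then show ?thesis using that by simp
  qed
  ultimately show "norm (exp s *\<^sub>R x) \<notin> {r1..r2}"
    using x by (auto simp: not_le not_less)
qed

text \<open>Dilation invariance applied to F ln q: after replacing ln q(e^d x) by d + ln q(x), the
  integral of F ln q equals d times the integral of F plus the integral of F(e^d x) ln q(x), all
  against the invariant measure. Only continuity of F enters.\<close>

lemma integral_log_dilation:
  fixes q F :: "'a::euclidean_space \<Rightarrow> real"
  assumes q: "continuous_on UNIV q" and pos: "\<And>x. x \<noteq> 0 \<Longrightarrow> 0 < q x"
    and hom: "\<And>x l. 0 < l \<Longrightarrow> q (l *\<^sub>R x) = l * q x"
    and F: "continuous_on UNIV F" and r: "0 < r1" "\<And>x. norm x \<notin> {r1..r2} \<Longrightarrow> F x = 0"
    and d: "0 < d" "d \<le> 1"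
  shows "(\<integral>x. F x * (1 / q x ^ DIM('a)) \<partial>lborel)
    = (\<integral>x. (F x - F (exp d *\<^sub>R x)) / d * ln (q x) * (1 / q x ^ DIM('a)) \<partial>lborel)"
proof -
  have q0: "q 0 = 0" using hom[of 2 0] by simp
  have q_nonneg: "0 \<le> q x" for x using pos[of x] q0 by (cases "x = 0") auto
  define w where "w x = 1 / q x ^ DIM('a)" for x
  have w: "homogeneous_weight w"
    unfolding w_def by (rule homogeneous_weight_inverse_power[OF q q_nonneg hom])
  define K where "K = cball (0::'a) r2 - ball 0 (r1 / exp 1)"
  have K: "compact K" unfolding K_def by (intro compact_diff) auto
  have K0: "x \<noteq> 0" if "x \<in> K" for x using that r(1) by (auto simp: K_def)
  have FK: "F (exp s *\<^sub>R x) = 0" if "x \<notin> K" "0 \<le> s" "s \<le> 1" for x s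
    by (rule zero_outside_annulus_dilation[where f = F]) (fact r that[unfolded K_def])+
  have Fc: "continuous_on K (\<lambda>x. F (c *\<^sub>R x))" for c
    by (rule continuous_on_compose2[OF F]) (intro continuous_intros, simp)
  have qc: "continuous_on K q" using q continuous_on_subset by blast
  have qK: "q x \<noteq> 0" if "x \<in> K" for x using pos K0[OF that] by force
  have lnc: "continuous_on K (\<lambda>x. ln (q x))"
    by (intro continuous_on_ln qc ballI qK)
  have wc: "continuous_on K w"
    unfolding w_def by (intro continuous_on_divide continuous_on_const continuous_on_power qc)
      (simp add: qK)
  have int1: "integrable lborel (\<lambda>x. F (exp s *\<^sub>R x) * ln (q x) * w x)" if "0 \<le> s" "s \<le> 1" for s
    by (rule integrable_continuous_compact_support[OF K
          continuous_on_mult[OF continuous_on_mult[OF Fc lnc] wc]]) (simp add: FK that)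
  have int0: "integrable lborel (\<lambda>x. F (exp s *\<^sub>R x) * w x)" if "0 \<le> s" "s \<le> 1" for s
    by (rule integrable_continuous_compact_support[OF K continuous_on_mult[OF Fc wc]])
      (simp add: FK that)
  have [measurable]: "F \<in> borel_measurable borel" "q \<in> borel_measurable borel"
    using F q by (auto intro: borel_measurable_continuous_onI)
  have w0: "w 0 = 0" by (rule homogeneous_weight_zero[OF w])
  have "(\<integral>x. F x * ln (q x) * w x \<partial>lborel)
      = (\<integral>x. F (exp d *\<^sub>R x) * ln (q (exp d *\<^sub>R x)) * w x \<partial>lborel)"
    by (rule integral_weight_dilation[OF w, symmetric]) auto
  also have "\<dots> = (\<integral>x. d * (F (exp d *\<^sub>R x) * w x) + F (exp d *\<^sub>R x) * ln (q x) * w x \<partial>lborel)"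
  proof (rule Bochner_Integration.integral_cong)
    fix x
    show "F (exp d *\<^sub>R x) * ln (q (exp d *\<^sub>R x)) * w x
      = d * (F (exp d *\<^sub>R x) * w x) + F (exp d *\<^sub>R x) * ln (q x) * w x"
      using pos[of x] w0 by (cases "x = 0") (auto simp: hom ln_mult algebra_simps)
  qed simp
  also have "\<dots> = d * (\<integral>x. F (exp d *\<^sub>R x) * w x \<partial>lborel) + (\<integral>x. F (exp d *\<^sub>R x) * ln (q x) * w x \<partial>lborel)"
    using int0[of d] int1[of d] d by simp
  also have "(\<integral>x. F (exp d *\<^sub>R x) * w x \<partial>lborel) = (\<integral>x. F x * w x \<partial>lborel)"
    by (rule integral_weight_dilation[OF w]) auto
  finally have "d * (\<integral>x. F x * w x \<partial>lborel)
      = (\<integral>x. F x * ln (q x) * w x \<partial>lborel) - (\<integral>x. F (exp d *\<^sub>R x) * ln (q x) * w x \<partial>lborel)"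
    by simp
  also have "\<dots> = (\<integral>x. F x * ln (q x) * w x - F (exp d *\<^sub>R x) * ln (q x) * w x \<partial>lborel)"
    using int1[of 0] int1[of d] d by (subst Bochner_Integration.integral_diff) auto
  also have "\<dots> = (\<integral>x. d * ((F x - F (exp d *\<^sub>R x)) / d * ln (q x) * w x) \<partial>lborel)"
    using d by (intro Bochner_Integration.integral_cong) (auto simp: field_simps)
  also have "\<dots> = d * (\<integral>x. (F x - F (exp d *\<^sub>R x)) / d * ln (q x) * w x \<partial>lborel)"
    by (rule integral_mult_right_zero)
  finally show ?thesis using d unfolding w_def by simp
qed

text \<open>The identity for F = |f|^N is bounded by integrals of difference quotients of f,
  dominated convergence sends the step to 0, and \<open>young_power\<close> concludes. The radius
  \<open>R0\<close> leaves room for the dilated points, where the bound on the derivative is also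
  used.\<close>

lemma hardy_log_radial:
  fixes q :: "'a::euclidean_space \<Rightarrow> real" and f :: "'a \<Rightarrow> 'b::real_normed_vector"
  defines "N \<equiv> DIM('a)"
  assumes q: "continuous_on UNIV q" and pos: "\<And>x. x \<noteq> 0 \<Longrightarrow> 0 < q x"
    and hom: "\<And>x l. 0 < l \<Longrightarrow> q (l *\<^sub>R x) = l * q x"
    and der: "\<And>x. (f has_derivative f' x) (at x)"
    and L: "\<And>x v. norm x \<le> R0 \<Longrightarrow> norm (f' x v) \<le> L * norm v"
    and meas [measurable]: "(\<lambda>x. norm (f' x x)) \<in> borel_measurable borel"
    and r: "0 < r1" "\<And>x. norm x \<notin> {r1..r2} \<Longrightarrow> f x = 0" and R0: "exp 1 * r2 \<le> R0"
  shows "(\<integral>\<^sup>+x. ennreal (norm (f x) ^ N / q x ^ N) \<partial>lborel) < \<infinity>"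
    and "(\<integral>\<^sup>+x. ennreal (norm (f x) ^ N / q x ^ N) \<partial>lborel)
      \<le> ennreal (N ^ N) * (\<integral>\<^sup>+x. ennreal ((\<bar>ln (q x)\<bar> * norm (f' x x)) ^ N / q x ^ N) \<partial>lborel)"
proof -
  have q0: "q 0 = 0" using hom[of 2 0] by simp
  have q_nonneg: "0 \<le> q x" for x using pos[of x] q0 by (cases "x = 0") auto
  have N: "0 < N" by (simp add: N_def)
  define w where "w x = 1 / q x ^ N" for x
  have w: "homogeneous_weight w"
    unfolding w_def N_def by (rule homogeneous_weight_inverse_power[OF q q_nonneg hom])
  have w_nonneg: "0 \<le> w x" for x using q_nonneg by (simp add: w_def)
  have fc: "continuous_on UNIV f"
    using der by (auto intro!: continuous_at_imp_continuous_on has_derivative_continuous)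
  have [measurable]: "(\<lambda>x. norm (f x)) \<in> borel_measurable borel" "q \<in> borel_measurable borel"
      "w \<in> borel_measurable borel"
    using fc q homogeneous_weight_measurable[OF w]
    by (auto intro!: borel_measurable_continuous_onI continuous_on_norm)
  define K where "K = cball (0::'a) r2 - ball 0 (r1 / exp 1)"
  have K: "compact K" unfolding K_def by (intro compact_diff) auto
  have K0: "x \<noteq> 0" if "x \<in> K" for x using that r(1) by (auto simp: K_def)
  have fK: "f (exp s *\<^sub>R x) = 0" if "x \<notin> K" "0 \<le> s" "s \<le> 1" for x s
    by (rule zero_outside_annulus_dilation[where f = f]) (fact r that[unfolded K_def])+
  have fK1: "f x = 0" if "x \<notin> K" for x using fK[OF that, of 0] by simp
  have qc: "continuous_on K q" using q continuous_on_subset by blast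
  have qK: "q x \<noteq> 0" if "x \<in> K" for x using pos K0[OF that] by force
  have lnc: "continuous_on K (\<lambda>x. ln (q x))"
    by (intro continuous_on_ln qc ballI qK)
  have wc: "continuous_on K w"
    unfolding w_def by (intro continuous_on_divide continuous_on_const continuous_on_power qc)
      (simp add: qK)
  obtain M where M: "norm (f x) \<le> M" for x
  proof -
    have "compact (f ` cball 0 r2)"
      by (intro compact_continuous_image continuous_on_subset[OF fc]) auto
    then obtain M where "norm (f x) \<le> M" if "x \<in> cball 0 r2" for x
      using compact_imp_bounded bounded_iff by (metis imageI)
    moreover have "f x = 0" if "x \<notin> cball 0 r2" for x
      using that by (intro r(2)) auto
    ultimately have "norm (f x) \<le> max M 0" for x
      by (cases "x \<in> cball 0 r2") (simp_all add: le_max_iff_disj)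
    then show ?thesis by (rule that)
  qed
  have M0: "0 \<le> M" using M[of 0] norm_ge_zero order_trans by blast
  define lam where "lam k = inverse (real (Suc k))" for k
  have lam: "0 < lam k" "lam k \<le> 1" for k
    by (auto simp: lam_def inverse_le_1_iff)
  define A where "A = (\<integral>x. norm (f x) ^ N * w x \<partial>lborel)"
  define \<Phi> where "\<Phi> x = real N * norm (f x) ^ (N - 1) * norm (f' x x) * \<bar>ln (q x)\<bar> * w x" for x
  \<comment> \<open>Majorises the integrand of the finite-step identity. It tends to
    \<open>\<Phi>\<close> because the derivative of f(e^s x) at s = 0 is f' x x.\<close>
  define \<Psi> where "\<Psi> k x = real N * max (norm (f x)) (norm (f (exp (lam k) *\<^sub>R x))) ^ (N - 1)
    * (norm (f (exp (lam k) *\<^sub>R x) - f x) / lam k) * \<bar>ln (q x)\<bar> * w x" for k x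
  \<comment> \<open>The mean value inequality on the convex ball of radius \<open>R0\<close>, with
    |e^s x - x| = (e^s - 1) |x| estimated by \<open>exp_minus_one_le\<close>.\<close>
  have Lip: "norm (f (exp (lam k) *\<^sub>R x) - f x) \<le> L * (lam k * exp 1 * r2)"
    if "x \<in> K" for x k
  proof -
    have xr: "norm x \<le> r2" using that by (simp add: K_def)
    have "exp (lam k) * norm x \<le> exp 1 * r2"
      using xr lam[of k] by (intro mult_mono) auto
    moreover have "norm x \<le> exp 1 * r2"
      using order_trans[OF mult_right_mono[of 1 "exp 1" "norm x"] mult_left_mono[OF xr, of "exp 1"]]
      by simp
    ultimately have mem: "exp (lam k) *\<^sub>R x \<in> cball 0 R0" "x \<in> cball 0 R0"
      using R0 by auto
    have "norm (f (exp (lam k) *\<^sub>R x) - f x) \<le> L * norm (exp (lam k) *\<^sub>R x - x)"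
      by (rule differentiable_bound[where S = "cball 0 R0" and f' = f'])
        (use mem L in \<open>auto intro!: onorm_le has_derivative_at_withinI[OF der]\<close>)
    also have "\<dots> \<le> L * (lam k * exp 1 * r2)"
    proof (rule mult_left_mono)
      have "norm (exp (lam k) *\<^sub>R x - x) = (exp (lam k) - 1) * norm x"
      proof -
        have "exp (lam k) *\<^sub>R x - x = (exp (lam k) - 1) *\<^sub>R x"
          by (simp add: scaleR_left_diff_distrib)
        then show ?thesis using lam[of k] by simp
      qed
      also have "\<dots> \<le> lam k * exp 1 * r2"
        using lam[of k] xr exp_minus_one_le[of "lam k"] by (intro mult_mono) auto
      finally show "norm (exp (lam k) *\<^sub>R x - x) \<le> lam k * exp 1 * r2" .
      \<comment> \<open>The sign of \<open>L\<close> is read off from the derivative bound at the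
        nonzero point x.\<close>
      have "0 \<le> L * norm x"
        using L[of x x] mem(2) norm_ge_zero order_trans by (metis dist_0_norm mem_cball)
      then show "0 \<le> L" using K0[OF that] by (simp add: zero_le_mult_iff)
    qed
    finally show ?thesis .
  qed
  have lim: "(\<lambda>k. \<Psi> k x) \<longlonglongrightarrow> \<Phi> x" for x
  proof -
    have lam0: "lam \<longlonglongrightarrow> 0"
      unfolding lam_def by (rule LIMSEQ_inverse_real_of_nat)
    have "((\<lambda>s. f (exp s *\<^sub>R x)) has_derivative (\<lambda>s. f' x (s *\<^sub>R x))) (at 0)"
    proof -
      have "((\<lambda>s::real. exp s *\<^sub>R x) has_derivative (\<lambda>s. s *\<^sub>R x)) (at 0)"
        by (auto intro!: derivative_eq_intros)
      from has_derivative_compose[OF this, of f "f' x"] der[of x] show ?thesis by simp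
    qed
    then have "((\<lambda>s. f (exp s *\<^sub>R x)) has_derivative (\<lambda>s. s *\<^sub>R f' x x)) (at 0)"
      by (simp add: linear_scale[OF has_derivative_linear[OF der]])
    from tendsto_difference_quotient[OF this]
    have "((\<lambda>s. (f (exp s *\<^sub>R x) - f x) /\<^sub>R s) \<longlongrightarrow> f' x x) (at 0)"
      by simp
    then have "(\<lambda>k. (f (exp (lam k) *\<^sub>R x) - f x) /\<^sub>R lam k) \<longlonglongrightarrow> f' x x"
      by (rule filterlim_compose) (use lam lam0 in \<open>auto simp: filterlim_at less_imp_neq[THEN not_sym]\<close>)
    from tendsto_norm[OF this]
    have 1: "(\<lambda>k. norm (f (exp (lam k) *\<^sub>R x) - f x) / lam k) \<longlonglongrightarrow> norm (f' x x)"
      using lam by (simp add: divide_inverse_commute less_imp_le)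
    have "(\<lambda>k. exp (lam k) *\<^sub>R x) \<longlonglongrightarrow> exp 0 *\<^sub>R x"
      by (intro tendsto_intros lam0)
    then have "(\<lambda>k. f (exp (lam k) *\<^sub>R x)) \<longlonglongrightarrow> f x"
      using fc by (intro isCont_tendsto_compose[of x f]) (auto simp: continuous_on_eq_continuous_at)
    then have "(\<lambda>k. max (norm (f x)) (norm (f (exp (lam k) *\<^sub>R x)))) \<longlonglongrightarrow> max (norm (f x)) (norm (f x))"
      by (intro tendsto_intros)
    then show ?thesis unfolding \<Psi>_def \<Phi>_def
      by (intro tendsto_intros 1) simp
  qed
  have \<Psi>K: "\<Psi> k x = 0" if "x \<notin> K" for x k
    using fK[OF that, of "lam k"] fK1[OF that] lam[of k] by (simp add: \<Psi>_def)
  \<comment> \<open>Independent of k: the factor \<open>lam k\<close> in \<open>Lip\<close> cancels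
    the division by the step.\<close>
  define B where "B x = real N * M ^ (N - 1) * (L * (exp 1 * r2)) * (indicator K x *\<^sub>R (\<bar>ln (q x)\<bar> * w x))" for x
  have intB: "integrable lborel B"
    unfolding B_def
    by (intro integrable_mult_right borel_integrable_compact K continuous_intros lnc wc)
  have max_nonneg: "0 \<le> max (norm (f x)) (norm (f (exp (lam k) *\<^sub>R x))) ^ (N - 1)" for k x
    by (intro zero_le_power) (simp add: le_max_iff_disj)
  have bound: "norm (\<Psi> k x) \<le> B x" for k x
  proof (cases "x \<in> K")
    case True
    have "real N * max (norm (f x)) (norm (f (exp (lam k) *\<^sub>R x))) ^ (N - 1)
        * (norm (f (exp (lam k) *\<^sub>R x) - f x) / lam k) * (\<bar>ln (q x)\<bar> * w x)
      \<le> real N * M ^ (N - 1) * (L * (exp 1 * r2)) * (\<bar>ln (q x)\<bar> * w x)"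
      using M M0 Lip[OF True, of k] lam[of k] w_nonneg
      by (intro mult_right_mono mult_mono power_mono)
        (auto simp: field_simps le_max_iff_disj intro!: zero_le_power)
    then show ?thesis using True w_nonneg[of x] lam[of k] max_nonneg[of x k]
      by (simp add: \<Psi>_def B_def abs_mult mult_ac)
  next
    case False
    then show ?thesis using \<Psi>K[OF False] by (simp add: B_def)
  qed
  have \<Psi>m: "\<Psi> k \<in> borel_measurable lborel" for k
  proof -
    have [measurable]: "(\<lambda>x. norm (f (exp (lam k) *\<^sub>R x) - f x)) \<in> borel_measurable borel"
      by (intro borel_measurable_continuous_onI continuous_intros fc
          continuous_on_compose2[OF fc]) auto
    show ?thesis unfolding \<Psi>_def by measurable
  qed
  have \<Phi>m: "\<Phi> \<in> borel_measurable lborel" unfolding \<Phi>_def by measurable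
  have int\<Phi>: "integrable lborel \<Phi>" and int\<Psi>: "\<And>k. integrable lborel (\<Psi> k)"
    and conv: "(\<lambda>k. integral\<^sup>L lborel (\<Psi> k)) \<longlonglongrightarrow> integral\<^sup>L lborel \<Phi>"
    using integrable_dominated_convergence[OF \<Phi>m \<Psi>m intB AE_I2 AE_I2, OF lim bound]
      integrable_dominated_convergence2[OF \<Phi>m \<Psi>m intB AE_I2 AE_I2, OF lim bound]
      integral_dominated_convergence[OF \<Phi>m \<Psi>m intB AE_I2 AE_I2, OF lim bound]
    by blast+
  have A_le: "A \<le> integral\<^sup>L lborel (\<Psi> k)" for k
  proof -
    let ?G = "\<lambda>x. (norm (f x) ^ N - norm (f (exp (lam k) *\<^sub>R x)) ^ N) / lam k * ln (q x) * w x"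
    have *: "norm (?G x) \<le> \<Psi> k x" for x
    proof -
      have "\<bar>norm (f x) ^ N - norm (f (exp (lam k) *\<^sub>R x)) ^ N\<bar>
        \<le> real N * max (norm (f x)) (norm (f (exp (lam k) *\<^sub>R x))) ^ (N - 1)
          * \<bar>norm (f x) - norm (f (exp (lam k) *\<^sub>R x))\<bar>"
        by (rule abs_diff_power_le) auto
      also have "\<dots> \<le> real N * max (norm (f x)) (norm (f (exp (lam k) *\<^sub>R x))) ^ (N - 1)
          * norm (f (exp (lam k) *\<^sub>R x) - f x)"
        using norm_triangle_ineq3[of "f (exp (lam k) *\<^sub>R x)" "f x"] max_nonneg[of x k]
        by (intro mult_left_mono) (auto simp: abs_minus_commute)
      finally have "\<bar>norm (f x) ^ N - norm (f (exp (lam k) *\<^sub>R x)) ^ N\<bar> * (\<bar>ln (q x)\<bar> * w x / lam k)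
        \<le> real N * max (norm (f x)) (norm (f (exp (lam k) *\<^sub>R x))) ^ (N - 1)
          * norm (f (exp (lam k) *\<^sub>R x) - f x) * (\<bar>ln (q x)\<bar> * w x / lam k)"
        using lam[of k] w_nonneg[of x] by (intro mult_right_mono) auto
      then show ?thesis using lam[of k] w_nonneg[of x] max_nonneg[of x k]
        by (simp add: \<Psi>_def abs_mult mult_ac)
    qed
    have "A = (\<integral>x. ?G x \<partial>lborel)"
      unfolding A_def w_def N_def
      by (rule integral_log_dilation[OF q pos hom, of _ r1 r2])
        (use r lam[of k] N in \<open>auto intro!: continuous_intros fc simp: N_def\<close>)
    also have "\<dots> \<le> norm (\<integral>x. ?G x \<partial>lborel)"
      by (simp only: real_norm_def abs_ge_self)
    also have "\<dots> \<le> (\<integral>x. norm (?G x) \<partial>lborel)"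
      by (rule integral_norm_bound)
    also have "\<dots> \<le> integral\<^sup>L lborel (\<Psi> k)"
      by (rule integral_mono'[OF int\<Psi> * order_trans[OF norm_ge_zero *]])
    finally show ?thesis .
  qed
  have A\<Phi>: "A \<le> integral\<^sup>L lborel \<Phi>"
    by (rule LIMSEQ_le_const[OF conv]) (use A_le in auto)
  have intA: "integrable lborel (\<lambda>x. norm (f x) ^ N * w x)"
    by (rule integrable_continuous_compact_support[OF K])
      (use fK1 N in \<open>auto intro!: continuous_intros wc continuous_on_subset[OF fc]\<close>)
  have lhs: "(\<integral>\<^sup>+x. ennreal (norm (f x) ^ N / q x ^ N) \<partial>lborel) = ennreal A"
    unfolding A_def using nn_integral_eq_integral[OF intA] w_nonneg by (simp add: w_def)
  then show "(\<integral>\<^sup>+x. ennreal (norm (f x) ^ N / q x ^ N) \<partial>lborel) < \<infinity>" by simp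
  define b where "b x = (\<bar>ln (q x)\<bar> * norm (f' x x)) ^ N * w x" for x
  have bm [measurable]: "b \<in> borel_measurable borel" unfolding b_def by measurable
  have b_nonneg: "0 \<le> b x" for x using w_nonneg by (simp add: b_def)
  show "(\<integral>\<^sup>+x. ennreal (norm (f x) ^ N / q x ^ N) \<partial>lborel)
      \<le> ennreal (N ^ N) * (\<integral>\<^sup>+x. ennreal ((\<bar>ln (q x)\<bar> * norm (f' x x)) ^ N / q x ^ N) \<partial>lborel)"
  proof (cases "(\<integral>\<^sup>+x. ennreal (b x) \<partial>lborel) = \<infinity>")
    case True
    then show ?thesis using N by (simp add: b_def w_def ennreal_mult_top)
  next
    case False
    then have intb: "integrable lborel b"
      using b_nonneg by (intro integrableI_nonneg) (auto simp: less_top)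
    \<comment> \<open>Young's inequality with a = |f| and y = N |ln q| |f' x x|; the N inside y is
      the origin of the constant N^N.\<close>
    have young: "real N * \<Phi> x \<le> (real N - 1) * (norm (f x) ^ N * w x) + real N ^ N * b x" for x
    proof -
      have "real N * norm (f x) ^ (N - 1) * (real N * (\<bar>ln (q x)\<bar> * norm (f' x x))) * w x
        \<le> ((real N - 1) * norm (f x) ^ N + (real N * (\<bar>ln (q x)\<bar> * norm (f' x x))) ^ N) * w x"
        by (intro mult_right_mono young_power w_nonneg) (use N in auto)
      then show ?thesis by (simp add: \<Phi>_def b_def power_mult_distrib algebra_simps)
    qed
    have "real N * integral\<^sup>L lborel \<Phi> = (\<integral>x. real N * \<Phi> x \<partial>lborel)" by simp
    also have "\<dots> \<le> (\<integral>x. (real N - 1) * (norm (f x) ^ N * w x) + real N ^ N * b x \<partial>lborel)"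
      using int\<Phi> intA intb young by (intro integral_mono) auto
    also have "\<dots> = (real N - 1) * A + real N ^ N * integral\<^sup>L lborel b"
      using intA intb by (simp add: A_def)
    \<comment> \<open>The term (N - 1) A is subtracted from both sides, A being a real
      number.\<close>
    finally have "A \<le> real N ^ N * integral\<^sup>L lborel b"
      using mult_left_mono[OF A\<Phi>, of "real N"] by (simp add: algebra_simps)
    then have "ennreal A \<le> ennreal (N ^ N) * ennreal (integral\<^sup>L lborel b)"
      by (simp add: ennreal_leI flip: ennreal_mult'' ennreal_mult')
    also have "ennreal (integral\<^sup>L lborel b) = (\<integral>\<^sup>+x. ennreal (b x) \<partial>lborel)"
      using nn_integral_eq_integral[OF intb] b_nonneg by simp
    finally show ?thesis unfolding lhs by (simp add: b_def w_def)
  qed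
qed

section \<open>Test functions, their gradients, and the passage to L^n norms\<close>

lemma frechet_derivative_eq_real_dot:
  assumes "f differentiable (at x)"
  shows "frechet_derivative f (at x) v = real_dot v (grad f x)"
proof -
  have lin: "linear (frechet_derivative f (at x))"
    using assms by (rule linear_frechet_derivative)
  have "frechet_derivative f (at x) v = frechet_derivative f (at x) (\<Sum>i\<in>UNIV. v $ i *\<^sub>R axis i 1)"
    using basis_expansion[of v] by (simp add: scalar_mult_eq_scaleR)
  also have "\<dots> = real_dot v (grad f x)"
    by (simp add: linear_sum[OF lin] linear_scale[OF lin] real_dot_def grad_def)
  finally show ?thesis .
qed

lemma norm_real_dot_le: "norm (real_dot v w) \<le> norm v * norm w"
proof -
  have "norm (real_dot v w) \<le> (\<Sum>i\<in>UNIV. norm (v $ i) * norm (w $ i))"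
    unfolding real_dot_def by (rule order_trans[OF norm_sum]) simp
  also have "\<dots> \<le> norm v * norm w"
    unfolding norm_vec_def using L2_set_mult_ineq[of "\<lambda>i. norm (v $ i)" "\<lambda>i. norm (w $ i)" UNIV] by simp
  finally show ?thesis .
qed

lemma real_dot_scaleR: "real_dot (c *\<^sub>R v) w = c *\<^sub>R real_dot v w"
  by (simp add: real_dot_def scaleR_sum_right)

text \<open>The closed support is compact and misses the origin, so it lies between two
  spheres.\<close>

lemma test_function_annulus:
  assumes "f \<in> test_functions U" "0 \<notin> U"
  obtains r1 r2 where "0 < r1" "\<And>x. norm x \<notin> {r1..r2} \<Longrightarrow> f x = 0"
proof -
  let ?S = "closure (support_on UNIV f)"
  have S: "compact ?S" "0 \<notin> ?S" using assms by (auto simp: test_functions_def)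
  have "open (- ?S)" by (simp add: open_Compl)
  with S(2) obtain r1 where r1: "0 < r1" "ball 0 r1 \<subseteq> - ?S"
    by (meson ComplI openE)
  obtain r2 where r2: "\<And>x. x \<in> ?S \<Longrightarrow> norm x \<le> r2"
    using compact_imp_bounded[OF S(1)] by (auto simp: bounded_iff)
  have S0: "f x = 0" if "x \<notin> ?S" for x
    using that closure_subset[of "support_on UNIV f"] by (auto simp: in_support_on)
  show ?thesis
  proof (rule that[OF r1(1)])
    show "f x = 0" if "norm x \<notin> {r1..r2}" for x
      using that r1(2) r2[of x] by (intro S0) (auto simp: subset_iff)
  qed
qed

text \<open>The complement of the closed support is open, so f vanishes near x and its gradient
  vanishes with it.\<close>

lemma test_function_outside:
  assumes "f \<in> test_functions U" "x \<notin> U"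
  shows "f x = 0" "grad f x = 0"
proof -
  let ?S = "closure (support_on UNIV f)"
  have x: "x \<in> - ?S" using assms by (auto simp: test_functions_def)
  have S0: "f y = 0" if "y \<in> - ?S" for y
    using that closure_subset[of "support_on UNIV f"] by (auto simp: in_support_on)
  show "f x = 0" using x by (rule S0)
  have "(f has_derivative (\<lambda>_. 0)) (at x)"
    by (rule has_derivative_transform_within_open[of "\<lambda>_. 0" _ _ _ "- ?S"]) (use x S0 in \<open>auto simp: open_Compl\<close>)
  from frechet_derivative_at[OF this] have "frechet_derivative f (at x) = (\<lambda>_. 0)" by simp
  then show "grad f x = 0" by (simp add: grad_def vec_eq_iff)
qed

lemma smooth_grad:
  fixes f :: "real ^ 'n \<Rightarrow> complex"
  assumes "smooth f"
  shows "(f has_derivative (\<lambda>v. real_dot v (grad f x))) (at x)" and "continuous_on UNIV (grad f)"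
proof -
  have c: "continuously_differentiable (Suc 0) f" using assms by (simp add: smooth_def)
  have "frechet_derivative f (at x) = (\<lambda>v. real_dot v (grad f x))"
    using c by (intro ext frechet_derivative_eq_real_dot) simp
  then show "(f has_derivative (\<lambda>v. real_dot v (grad f x))) (at x)"
    using continuously_differentiable_has_derivative[OF c, of x] by simp
  show "continuous_on UNIV (grad f)"
    unfolding grad_def using c by (intro continuous_on_vec_lambda) simp
qed

lemma test_function_hardy:
  fixes q :: "real ^ 'n \<Rightarrow> real" and f :: "real ^ 'n \<Rightarrow> complex"
  defines "N \<equiv> CARD('n)"
  assumes q: "homogeneous_quasinorm q" and f: "f \<in> test_functions U" and U: "0 \<notin> U"
  shows "(\<integral>\<^sup>+x. ennreal (norm (f x) ^ N / q x ^ N) \<partial>lborel) < \<infinity>"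
    and "(\<integral>\<^sup>+x. ennreal (norm (f x) ^ N / q x ^ N) \<partial>lborel) \<le> ennreal (N ^ N) *
      (\<integral>\<^sup>+x. ennreal ((\<bar>ln (q x)\<bar> * norm (real_dot x (grad f x))) ^ N / q x ^ N) \<partial>lborel)"
proof -
  from test_function_annulus[OF f U] obtain r1 r2
    where r: "0 < r1" "\<And>x. norm x \<notin> {r1..r2} \<Longrightarrow> f x = 0" by metis
  have "smooth f" using f by (simp add: test_functions_def)
  note g = smooth_grad[OF this]
  have "compact (grad f ` cball 0 (exp 1 * r2))"
    by (intro compact_continuous_image continuous_on_subset[OF g(2)]) auto
  then obtain L where L: "norm (grad f x) \<le> L" if "x \<in> cball 0 (exp 1 * r2)" for x
    using compact_imp_bounded bounded_iff by (metis imageI)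
  have "continuous_on UNIV (\<lambda>x. real_dot x (grad f x))"
    unfolding real_dot_def by (intro continuous_intros g(2))
  then have m: "(\<lambda>x. norm (real_dot x (grad f x))) \<in> borel_measurable borel"
    by (intro borel_measurable_continuous_onI continuous_on_norm)
  have Lv: "norm (real_dot v (grad f x)) \<le> L * norm v" if "norm x \<le> exp 1 * r2" for x v
    using norm_real_dot_le[of v "grad f x"] mult_left_mono[OF L[of x], of "norm v"] that
    by (simp add: mult.commute)
  have q': "continuous_on UNIV q" "\<And>x. x \<noteq> 0 \<Longrightarrow> 0 < q x" "\<And>x l. 0 < l \<Longrightarrow> q (l *\<^sub>R x) = l * q x"
    using q by (auto simp: homogeneous_quasinorm_def less_le)
  note h = hardy_log_radial[OF q' g(1) Lv m r order_refl]
  show "(\<integral>\<^sup>+x. ennreal (norm (f x) ^ N / q x ^ N) \<partial>lborel) < \<infinity>"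
    using h(1) by (simp add: N_def)
  show "(\<integral>\<^sup>+x. ennreal (norm (f x) ^ N / q x ^ N) \<partial>lborel) \<le> ennreal (N ^ N) *
      (\<integral>\<^sup>+x. ennreal ((\<bar>ln (q x)\<bar> * norm (real_dot x (grad f x))) ^ N / q x ^ N) \<partial>lborel)"
    using h(2) by (simp add: N_def)
qed

text \<open>With both integrals finite, \<open>Lp_norm\<close> is an honest p-th root, and
  monotonicity of powers reduces norm estimates to integral estimates. Infinite integrals are
  treated separately where they can occur.\<close>

lemma Lp_norm_le_mult_iff:
  fixes g :: "'a::euclidean_space \<Rightarrow> 'b::real_normed_vector" and h :: "'a \<Rightarrow> 'c::real_normed_vector"
  assumes p: "0 < p" and C: "0 \<le> C"
    and I: "(\<integral>\<^sup>+x\<in>A. ennreal (norm (g x) powr p) \<partial>lborel) = ennreal I" "0 \<le> I"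
    and J: "(\<integral>\<^sup>+x\<in>B. ennreal (norm (h x) powr p) \<partial>lborel) = ennreal J" "0 \<le> J"
  shows "Lp_norm p A g \<le> ennreal C * Lp_norm p B h \<longleftrightarrow> I \<le> C powr p * J"
proof -
  have "Lp_norm p A g \<le> ennreal C * Lp_norm p B h \<longleftrightarrow> I powr (1 / p) \<le> C * J powr (1 / p)"
    using I J C by (simp add: Lp_norm_def flip: ennreal_mult)
  also have "C * J powr (1 / p) = (C powr p * J) powr (1 / p)"
    using C J p by (simp add: powr_mult powr_powr)
  also have "I powr (1 / p) \<le> \<dots> \<longleftrightarrow> I \<le> C powr p * J"
  proof
    assume "I powr (1 / p) \<le> (C powr p * J) powr (1 / p)"
    from powr_mono2[OF _ _ this, of p] show "I \<le> C powr p * J"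
      using p I J by (simp add: powr_powr)
  qed (use p I in \<open>auto intro!: powr_mono2\<close>)
  finally show ?thesis .
qed

lemma Lp_norm_top:
  "(\<integral>\<^sup>+x\<in>A. ennreal (norm (g x) powr p) \<partial>lborel) = \<infinity> \<Longrightarrow> Lp_norm p A g = \<infinity>"
  by (simp add: Lp_norm_def)

text \<open>Both integrands vanish off U, so B can be replaced by the whole space. As N is positive,
  \<open>powr\<close> agrees with the natural power even at base 0.\<close>

lemma quasinorm_integrals:
  fixes q :: "real ^ 'n \<Rightarrow> real"
  defines "N \<equiv> CARD('n)"
  assumes q: "homogeneous_quasinorm q" and f: "f \<in> test_functions U" and U: "U \<subseteq> B"
  shows "(\<integral>\<^sup>+x\<in>B. ennreal (norm (f x /\<^sub>R q x) powr real N) \<partial>lborel)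
      = (\<integral>\<^sup>+x. ennreal (norm (f x) ^ N / q x ^ N) \<partial>lborel)"
    and "(\<integral>\<^sup>+x\<in>B. ennreal (norm (ln (q x) *\<^sub>R real_dot (x /\<^sub>R q x) (grad f x)) powr real N) \<partial>lborel)
      = (\<integral>\<^sup>+x. ennreal ((\<bar>ln (q x)\<bar> * norm (real_dot x (grad f x))) ^ N / q x ^ N) \<partial>lborel)"
proof -
  have N: "N \<noteq> 0" by (simp add: N_def)
  have q0: "0 \<le> q x" for x using q by (simp add: homogeneous_quasinorm_def)
  have out: "f x = 0" "grad f x = 0" if "x \<notin> B" for x
    using test_function_outside[OF f] that U by auto
  show "(\<integral>\<^sup>+x\<in>B. ennreal (norm (f x /\<^sub>R q x) powr real N) \<partial>lborel)
      = (\<integral>\<^sup>+x. ennreal (norm (f x) ^ N / q x ^ N) \<partial>lborel)"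
    using N q0 out by (intro nn_integral_cong)
      (auto simp: powr_realpow' indicator_def power_mult_distrib power_inverse field_simps)
  show "(\<integral>\<^sup>+x\<in>B. ennreal (norm (ln (q x) *\<^sub>R real_dot (x /\<^sub>R q x) (grad f x)) powr real N) \<partial>lborel)
      = (\<integral>\<^sup>+x. ennreal ((\<bar>ln (q x)\<bar> * norm (real_dot x (grad f x))) ^ N / q x ^ N) \<partial>lborel)"
    using N q0 out by (intro nn_integral_cong)
      (auto simp: powr_realpow' indicator_def power_mult_distrib power_inverse field_simps
        real_dot_scaleR real_dot_def[of _ 0])
qed

text \<open>The domain B is kept general in order to serve both the quasi-ball and the whole
  space.\<close>

lemma quasinorm_hardy:
  fixes q :: "real ^ 'n \<Rightarrow> real"
  defines "n \<equiv> real CARD('n)"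
  assumes q: "homogeneous_quasinorm q" and f: "f \<in> test_functions U" and U: "U \<subseteq> B" "0 \<notin> U"
  shows "Lp_norm n B (\<lambda>x. f x /\<^sub>R q x)
    \<le> ennreal n * Lp_norm n B (\<lambda>x. ln (q x) *\<^sub>R real_dot (x /\<^sub>R q x) (grad f x))"
proof -
  have n: "0 < n" by (simp add: n_def)
  note I = quasinorm_integrals[OF q f U(1), folded n_def]
  note h = test_function_hardy[OF q f U(2), folded I[unfolded n_def]]
  let ?J = "\<integral>\<^sup>+x\<in>B. ennreal (norm (ln (q x) *\<^sub>R real_dot (x /\<^sub>R q x) (grad f x)) powr n) \<partial>lborel"
  let ?I = "\<integral>\<^sup>+x\<in>B. ennreal (norm (f x /\<^sub>R q x) powr n) \<partial>lborel"
  show ?thesis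
  proof (cases "?J = \<infinity>")
    case True
    show ?thesis unfolding Lp_norm_top[OF True] using n by (simp add: ennreal_mult_top)
  next
    case False
    then obtain J where J: "?J = ennreal J" "0 \<le> J" by (cases ?J) auto
    have "?I < \<infinity>" using h(1) by (simp add: n_def)
    then obtain I where I: "?I = ennreal I" "0 \<le> I" by (cases ?I) auto
    have "ennreal I \<le> ennreal (CARD('n) ^ CARD('n)) * ennreal J"
      using h(2) I(1) J(1) by (simp add: n_def)
    then have "I \<le> real CARD('n) ^ CARD('n) * J"
      using J(2) by (simp flip: ennreal_mult)
    then show ?thesis
      unfolding Lp_norm_le_mult_iff[OF n less_imp_le[OF n] I J] by (simp add: n_def powr_realpow')
  qed
qed

lemma homogeneous_quasinorm_norm: "homogeneous_quasinorm norm"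
  by (auto simp: homogeneous_quasinorm_def intro: continuous_intros)

lemma Lp_norm_mono:
  assumes "0 < p" "\<And>x. x \<in> A \<Longrightarrow> norm (g x) \<le> norm (h x)"
  shows "Lp_norm p A g \<le> Lp_norm p A h"
proof -
  let ?I = "\<integral>\<^sup>+x\<in>A. ennreal (norm (g x) powr p) \<partial>lborel"
  let ?J = "\<integral>\<^sup>+x\<in>A. ennreal (norm (h x) powr p) \<partial>lborel"
  have le: "?I \<le> ?J"
    using assms by (intro nn_integral_mono) (auto simp: indicator_def intro!: ennreal_leI powr_mono2)
  show ?thesis
  proof (cases "?J = \<infinity>")
    case True
    then show ?thesis by (simp add: Lp_norm_top)
  next
    case False
    then have "enn2real ?I \<le> enn2real ?J"
      using le by (intro enn2real_mono) (auto simp: less_top)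
    moreover have "?I \<noteq> \<infinity>" using False le by (auto simp: top_unique)
    ultimately show ?thesis
      using False assms(1) by (auto simp: Lp_norm_def intro!: ennreal_leI powr_mono2)
  qed
qed

text \<open>By Cauchy-Schwarz the radial derivative is at most |grad f|, so the estimate for q =
  \<open>norm\<close> implies this one.\<close>

lemma euclidean_hardy:
  fixes f :: "real ^ 'n \<Rightarrow> complex"
  defines "n \<equiv> real CARD('n)"
  assumes f: "f \<in> test_functions (UNIV - {0})"
  shows "Lp_norm n UNIV (\<lambda>x. f x /\<^sub>R norm x) \<le> ennreal n * Lp_norm n UNIV (\<lambda>x. ln (norm x) *\<^sub>R grad f x)"
proof -
  have "Lp_norm n UNIV (\<lambda>x. f x /\<^sub>R norm x)
      \<le> ennreal n * Lp_norm n UNIV (\<lambda>x. ln (norm x) *\<^sub>R real_dot (x /\<^sub>R norm x) (grad f x))"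
    unfolding n_def by (rule quasinorm_hardy[OF homogeneous_quasinorm_norm f]) auto
  also have "\<dots> \<le> ennreal n * Lp_norm n UNIV (\<lambda>x. ln (norm x) *\<^sub>R grad f x)"
  proof (intro mult_left_mono Lp_norm_mono)
    fix x :: "real ^ 'n"
    have "norm (real_dot (x /\<^sub>R norm x) (grad f x)) \<le> 1 * norm (grad f x)"
      by (rule order_trans[OF norm_real_dot_le mult_right_mono]) (auto simp: divide_simps)
    then show "norm (ln (norm x) *\<^sub>R real_dot (x /\<^sub>R norm x) (grad f x)) \<le> norm (ln (norm x) *\<^sub>R grad f x)"
      by (simp add: mult_left_mono)
  qed (auto simp: n_def)
  finally show ?thesis .
qed

section \<open>Optimality of the constant\<close>

lemma nn_integral_pos_on_open:
  fixes f :: "'a::euclidean_space \<Rightarrow> ennreal"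
  assumes [measurable]: "f \<in> borel_measurable borel" and "open S" "S \<noteq> {}" "\<And>x. x \<in> S \<Longrightarrow> 0 < f x"
  shows "0 < (\<integral>\<^sup>+x. f x \<partial>lborel)"
proof (rule ccontr)
  assume "\<not> 0 < (\<integral>\<^sup>+x. f x \<partial>lborel)"
  then have "AE x in lborel. f x = 0"
    by (simp add: nn_integral_0_iff_AE)
  then have "AE x in lborel. x \<notin> S"
    by eventually_elim (use assms(4) in force)
  then have "S \<in> null_sets lborel"
    using assms(2) by (subst (asm) AE_iff_null_sets[symmetric]) auto
  then have "negligible S"
    by (simp add: negligible_iff_null_sets null_sets_completionI)
  then show False using assms(2,3) open_not_negligible by blast
qed

text \<open>The constant in \<open>nn_integral_radial\<close> is the weight of the shell between
  radii 1/e and 1: finite because w is bounded there, positive because w is positive on an open part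
  of it.\<close>

lemma radial_constant:
  fixes w :: "'a::euclidean_space \<Rightarrow> real"
  assumes w: "homogeneous_weight w" and W: "\<And>x. exp (- 1) \<le> norm x \<Longrightarrow> norm x \<le> 1 \<Longrightarrow> w x \<le> W"
    and S: "open S" "S \<noteq> {}" "\<And>x. x \<in> S \<Longrightarrow> exp (- 1) < norm x \<and> norm x < 1 \<and> 0 < w x"
  shows "\<exists>c>0. \<forall>h\<in>borel_measurable borel.
    (\<integral>\<^sup>+x. h (ln (norm x)) * ennreal (w x) \<partial>lborel) = ennreal c * (\<integral>\<^sup>+t. h t \<partial>lborel)"
proof -
  note [measurable] = homogeneous_weight_measurable[OF w]
  let ?c = "\<integral>\<^sup>+x. indicator {0..1} (- ln (norm x)) * ennreal (w x) \<partial>(lborel :: 'a measure)"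
  have "?c \<le> (\<integral>\<^sup>+x. ennreal \<bar>W\<bar> * indicator (cball 0 1) x \<partial>(lborel :: 'a measure))"
  proof (rule nn_integral_mono)
    fix x :: 'a
    show "indicator {0..1} (- ln (norm x)) * ennreal (w x) \<le> ennreal \<bar>W\<bar> * indicator (cball 0 1) x"
    proof (cases "x \<noteq> 0 \<and> - ln (norm x) \<in> {0..1}")
      case True
      then have "norm x \<le> 1" "exp (- 1) \<le> norm x"
        by (auto simp: ln_ge_iff[of "norm x" "-1"] algebra_simps)
      then show ?thesis using W[of x] True by (auto intro!: ennreal_leI)
    qed (auto simp: homogeneous_weight_zero[OF w])
  qed
  also have "\<dots> < \<infinity>"
    using emeasure_compact_finite[of "cball (0::'a) 1"]
    by (simp add: nn_integral_cmult_indicator ennreal_mult_less_top)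
  finally have fin: "?c < \<infinity>" .
  have pos: "0 < ?c"
  proof (rule nn_integral_pos_on_open[OF _ S(1,2)])
    fix x assume "x \<in> S"
    with S(3) have x: "exp (- 1) < norm x" "norm x < 1" "0 < w x" by auto
    then have "0 < norm x" by (smt (verit) exp_gt_zero)
    then have "- ln (norm x) \<in> {0..1}"
      using x ln_ge_iff[of "norm x" "-1"] by (simp add: ln_le_zero_iff)
    then show "0 < indicator {0..1} (- ln (norm x)) * ennreal (w x)"
      using x by (simp add: ennreal_zero_less_mult_iff)
  qed measurable
  from fin obtain c where c: "?c = ennreal c" "0 \<le> c" by (cases ?c) auto
  show ?thesis
  proof (intro exI[of _ c] conjI ballI)
    show "0 < c" using pos c by simp
    show "(\<integral>\<^sup>+x. h (ln (norm x)) * ennreal (w x) \<partial>lborel) = ennreal c * (\<integral>\<^sup>+t. h t \<partial>lborel)"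
      if "h \<in> borel_measurable borel" for h
      using nn_integral_radial[OF w that] c(1) by simp
  qed
qed

text \<open>The invariant measure dt / |t|, restricted to t < 0 because the profiles used for
  optimality live on negative values of ln |x|.\<close>

lemma homogeneous_weight_halfline: "homogeneous_weight (\<lambda>t::real. if t < 0 then 1 / (- t) else 0)"
  by (auto simp: homogeneous_weight_def mult_less_0_iff field_simps)

text \<open>The substitution u = ln |t| for t < 0, as the one-dimensional case of
  \<open>radial_constant\<close>.\<close>

lemma exists_halfline_constant:
  "\<exists>c>0. \<forall>h\<in>borel_measurable borel.
    (\<integral>\<^sup>+t. h (ln \<bar>t\<bar>) * ennreal (if t < 0 then 1 / (- t) else 0) \<partial>lborel)
      = ennreal c * (\<integral>\<^sup>+u. h u \<partial>(lborel :: real measure))"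
proof -
  have e: "exp (-1::real) < 1" by simp
  have "(\<lambda>t::real. if t < 0 then 1 / (- t) else 0) t \<le> exp 1" if "exp (-1) \<le> norm t" "norm t \<le> 1" for t
    using that by (auto simp: exp_minus field_simps)
  moreover have "{-1<..<- exp (-1::real)} \<noteq> {}" "open {-1<..<- exp (-1::real)}"
    using e by simp_all
  moreover have "exp (-1) < norm t \<and> norm t < 1 \<and> 0 < (if t < 0 then 1 / (- t) else 0)"
    if "t \<in> {-1<..<- exp (-1::real)}" for t
  proof -
    have "t < - exp (-1)" "- exp (-1) < (0::real)" using that by auto
    then have "t < 0" by linarith
    then show ?thesis using that by auto
  qed
  ultimately show ?thesis
    using radial_constant[OF homogeneous_weight_halfline, of "exp 1" "{-1<..<- exp (-1)}"]
    unfolding real_norm_def by blast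
qed

text \<open>Compactness of the closed shell bounds 1 / q^n there, and the open shell gives
  positivity.\<close>

lemma exists_quasinorm_constant:
  fixes q :: "real ^ 'n \<Rightarrow> real"
  assumes q: "homogeneous_quasinorm q"
  shows "\<exists>c>0. \<forall>h\<in>borel_measurable borel.
    (\<integral>\<^sup>+x. h (ln (norm x)) * ennreal (1 / q x ^ CARD('n)) \<partial>lborel) = ennreal c * (\<integral>\<^sup>+t. h t \<partial>lborel)"
proof -
  have qc: "continuous_on UNIV q" and q0: "\<And>x. 0 \<le> q x" and qz: "\<And>x. q x = 0 \<longleftrightarrow> x = 0"
    and qh: "\<And>x l. 0 < l \<Longrightarrow> q (l *\<^sub>R x) = l * q x"
    using q by (auto simp: homogeneous_quasinorm_def)
  have w: "homogeneous_weight (\<lambda>x. 1 / q x ^ CARD('n))"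
    using homogeneous_weight_inverse_power[OF qc q0 qh] by simp
  define K where "K = cball (0 :: real ^ 'n) 1 - ball 0 (exp (- 1))"
  have K: "compact K" unfolding K_def by (intro compact_diff) auto
  have K0: "x \<noteq> 0" if "x \<in> K" for x using that by (auto simp: K_def)
  have "continuous_on K (\<lambda>x. 1 / q x ^ CARD('n))"
    by (intro continuous_intros continuous_on_subset[OF qc]) (auto simp: qz K0)
  from compact_imp_bounded[OF compact_continuous_image[OF this K]]
  obtain W where W0: "\<forall>y\<in>(\<lambda>x. 1 / q x ^ CARD('n)) ` K. norm y \<le> W"
    unfolding bounded_iff by (elim exE)
  have W: "1 / q x ^ CARD('n) \<le> W" if "x \<in> K" for x
    by (rule order_trans[OF abs_ge_self]) (use W0 that in \<open>auto simp del: abs_divide\<close>)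
  define S where "S = ball (0 :: real ^ 'n) 1 - cball 0 (exp (- 1))"
  have S: "open S" unfolding S_def by (intro open_Diff) auto
  obtain v :: "real ^ 'n" where v: "norm v = (1 + exp (-1)) / 2"
    using vector_choose_size[of "(1 + exp (-1)) / 2"] by (auto simp: add_nonneg_nonneg)
  have "exp (-1::real) < 1" by simp
  then have "exp (-1) < norm v \<and> norm v < 1" unfolding v by argo
  then have "v \<in> S" by (simp add: S_def)
  then have "S \<noteq> {}" by auto
  moreover have "exp (- 1) < norm x \<and> norm x < 1 \<and> 0 < 1 / q x ^ CARD('n)" if "x \<in> S" for x
  proof -
    have "x \<noteq> 0" using that by (auto simp: S_def)
    then have "0 < q x" using q0[of x] qz[of x] by linarith
    then show ?thesis using that by (simp add: S_def)
  qed
  moreover have "1 / q x ^ CARD('n) \<le> W" if "exp (- 1) \<le> norm x" "norm x \<le> 1" for x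
    using W[of x] that by (simp add: K_def)
  ultimately show ?thesis
    using radial_constant[OF w _ S] by blast
qed

section \<open>The one-dimensional near-extremal profile\<close>

lemma smooth_upto_UNIV_split:
  assumes "A \<union> B = UNIV" "smooth_upto k A f" "smooth_upto k B f"
  shows "smooth_upto k UNIV f"
  using assms smooth_upto_Un[of k A B f] by simp

lemma smooth_upto_uminus: "open S \<Longrightarrow> smooth_upto k S (\<lambda>t. - t)"
  using smooth_upto_mult[OF _ smooth_upto_const[of S k "-1"] smooth_upto_ident] by simp

text \<open>The variable t stands for ln |x|. The power is the borderline extremal of the
  one-dimensional Hardy inequality for g against t g'. The bump cuts it off between -t = T and -t =
  T e^M, slowly on the scale of ln (- t), so that the cutoff costs only a term with factor 1 /
  M.\<close>

definition log_profile :: "(real \<Rightarrow> real) \<Rightarrow> nat \<Rightarrow> real \<Rightarrow> real \<Rightarrow> real \<Rightarrow> real" where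
  "log_profile b N T M t =
     (if t < 0 then (- t) powr (- (1 / N)) * b ((ln (- t) - ln T) / M) else 0)"

context
  fixes b :: "real \<Rightarrow> real" and N :: nat and T M :: real
  assumes b: "\<And>k. smooth_upto k UNIV b" "\<And>x. 0 \<le> b x" "\<And>x. 0 < b x \<longleftrightarrow> 0 < x \<and> x < 1"
    and N: "0 < N" and T: "0 < T" and M: "0 < M"
begin

lemma bump_eq_0: "x \<le> 0 \<or> 1 \<le> x \<Longrightarrow> b x = 0"
  using b(2,3)[of x] by linarith

lemma log_profile_eq_0: "t \<notin> {- (T * exp M)..- T} \<Longrightarrow> log_profile b N T M t = 0"
proof -
  assume t: "t \<notin> {- (T * exp M)..- T}"
  have "(ln (- t) - ln T) / M \<le> 0 \<or> 1 \<le> (ln (- t) - ln T) / M" if "t < 0"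
  proof (cases "- T < t")
    case True
    then have "ln (- t) \<le> ln T" using that T by (subst ln_le_cancel_iff) auto
    then show ?thesis using M by (simp add: divide_le_0_iff)
  next
    case False
    then have "T * exp M \<le> - t" using t by auto
    then have "ln (T * exp M) \<le> ln (- t)" using that T by (subst ln_le_cancel_iff) auto
    then show ?thesis using M T by (simp add: ln_mult)
  qed
  then show ?thesis using bump_eq_0 by (auto simp: log_profile_def)
qed

text \<open>For t < 0 this is a composition of smooth functions, and for t > -T it vanishes. As T >
  0, the two open half-lines overlap and cover the line.\<close>

lemma smooth_log_profile: "smooth_upto k UNIV (log_profile b N T M)"
proof (rule smooth_upto_UNIV_split[of "{..<0}" "{- T<..}"])
  have o: "open {..<0::real}" by simp
  have neg: "smooth_upto k {..<0} (\<lambda>t. - t)" by (rule smooth_upto_uminus[OF o])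
  have 1: "smooth_upto k {..<0} (\<lambda>t. (- t) powr (- (1 / N)))"
    by (rule smooth_upto_compose[OF o _ smooth_upto_powr neg]) simp
  have 2: "smooth_upto k {..<0} (\<lambda>t. ln (- t))"
    by (rule smooth_upto_compose[OF o _ smooth_upto_ln neg]) simp
  have 3: "smooth_upto k {..<0} (\<lambda>t. (ln (- t) + - ln T) * (1 / M))"
    by (rule smooth_upto_mult[OF o smooth_upto_add[OF o 2 smooth_upto_const[OF o]] smooth_upto_const[OF o]])
  have 4: "smooth_upto k {..<0} (\<lambda>t. b ((ln (- t) + - ln T) * (1 / M)))"
    by (rule smooth_upto_compose[OF o UNIV_I b(1) 3])
  show "smooth_upto k {..<0} (log_profile b N T M)"
    by (rule smooth_upto_cong[OF o _ smooth_upto_mult[OF o 1 4]]) (simp add: log_profile_def)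
  show "smooth_upto k {- T<..} (log_profile b N T M)"
    by (rule smooth_upto_cong[OF _ _ smooth_upto_const[of _ _ 0]]) (auto intro!: log_profile_eq_0)
qed (use T in auto)

text \<open>Differentiating the power contributes b / N and differentiating the bump contributes -
  b' / M, with the same power of - t in front.\<close>

lemma deriv_log_profile:
  assumes "t < 0"
  shows "deriv (log_profile b N T M) t = (- t) powr (- (1 / N) - 1)
    * (b ((ln (- t) - ln T) / M) / N - deriv b ((ln (- t) - ln T) / M) / M)"
proof (rule DERIV_imp_deriv)
  define y where "y t = (ln (- t) - ln T) / M" for t
  have dy: "(y has_field_derivative 1 / (t * M)) (at t)"
    unfolding y_def using assms M by (auto intro!: derivative_eq_intros simp: field_simps)
  have db: "(b has_field_derivative deriv b (y t)) (at (y t))"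
    using smooth_upto_DERIV[OF b(1) UNIV_I] .
  have dby: "((\<lambda>t. b (y t)) has_field_derivative deriv b (y t) * (1 / (t * M))) (at t)"
    by (rule DERIV_chain2[OF db dy])
  have "((\<lambda>s. s powr (- (1 / N))) has_field_derivative (- (1 / N)) * (- t) powr (- (1 / N) - 1)) (at (- t))"
    using assms by (intro has_real_derivative_powr) simp
  from DERIV_chain2[OF this DERIV_minus[OF DERIV_ident]]
  have dp: "((\<lambda>t. (- t) powr (- (1 / N))) has_field_derivative
      (- (1 / N)) * (- t) powr (- (1 / N) - 1) * - 1) (at t)" .
  have "(- t) powr (- (1 / N)) = (- t) powr (- (1 / N) - 1) * (- t)"
    using assms by (simp add: powr_diff)
  then have "(- (1 / N)) * (- t) powr (- (1 / N) - 1) * - 1 * b (y t)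
        + deriv b (y t) * (1 / (t * M)) * (- t) powr (- (1 / N))
      = (- t) powr (- (1 / N) - 1) * (b (y t) / N - deriv b (y t) / M)"
    using assms M by (simp add: field_simps)
  with DERIV_mult[OF dp dby]
  have "((\<lambda>t. (- t) powr (- (1 / N)) * b (y t)) has_field_derivative
      (- t) powr (- (1 / N) - 1) * (b (y t) / N - deriv b (y t) / M)) (at t)" by simp
  then have "((\<lambda>t. (- t) powr (- (1 / N)) * b ((ln (- t) - ln T) / M)) has_field_derivative
      (- t) powr (- (1 / N) - 1) * (b ((ln (- t) - ln T) / M) / N - deriv b ((ln (- t) - ln T) / M) / M)) (at t)"
    by (simp add: y_def)
  then show "(log_profile b N T M has_field_derivative
      (- t) powr (- (1 / N) - 1) * (b ((ln (- t) - ln T) / M) / N - deriv b ((ln (- t) - ln T) / M) / M)) (at t)"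
    by (rule has_field_derivative_transform_within_open[of _ _ _ "{..<0}"])
      (use assms in \<open>auto simp: log_profile_def\<close>)
qed

lemma deriv_log_profile_eq_0: "- T < t \<Longrightarrow> deriv (log_profile b N T M) t = 0"
  using deriv_cong_open[of "{- T<..}" t "log_profile b N T M" "\<lambda>_. 0"] log_profile_eq_0 by auto

text \<open>The exponent -1/N is chosen so that the N-th power is exactly the weight 1 / (- t).
  Writing ln |t| fits \<open>exists_halfline_constant\<close>.\<close>

lemma abs_log_profile_power:
  "\<bar>log_profile b N T M t\<bar> ^ N
    = b ((ln \<bar>t\<bar> - ln T) / M) ^ N * (if t < 0 then 1 / (- t) else 0)"
proof (cases "t < 0")
  case True
  have "((- t) powr (- (1 / N))) ^ N = 1 / (- t)"
    using True N by (simp add: powr_minus_divide powr_powr powr_realpow[symmetric] powr_divide)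
  then show ?thesis using True b(2) by (simp add: log_profile_def power_mult_distrib abs_mult)
qed (use N in \<open>simp add: log_profile_def\<close>)

text \<open>The factor |t| restores the power lost by differentiation, so the same weight appears as
  for the profile itself.\<close>

lemma abs_deriv_log_profile_power:
  "(\<bar>t\<bar> * \<bar>deriv (log_profile b N T M) t\<bar>) ^ N
    = \<bar>b ((ln \<bar>t\<bar> - ln T) / M) / N - deriv b ((ln \<bar>t\<bar> - ln T) / M) / M\<bar> ^ N
      * (if t < 0 then 1 / (- t) else 0)"
proof (cases "t < 0")
  case True
  have "((- t) powr (- (1 / N))) ^ N = 1 / (- t)"
    using True N by (simp add: powr_minus_divide powr_powr powr_realpow[symmetric] powr_divide)
  moreover have e: "- t * (- t) powr (- (1 / N) - 1) = (- t) powr (- (1 / N))"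
    using True by (simp add: powr_diff)
  have "\<bar>t\<bar> * \<bar>deriv (log_profile b N T M) t\<bar> = - t * (- t) powr (- (1 / N) - 1)
      * \<bar>b ((ln \<bar>t\<bar> - ln T) / M) / N - deriv b ((ln \<bar>t\<bar> - ln T) / M) / M\<bar>"
    using True by (simp add: deriv_log_profile abs_mult)
  note this[unfolded e]
  ultimately show ?thesis using True by (simp add: power_mult_distrib)
qed (use T N in \<open>simp add: deriv_log_profile_eq_0\<close>)

end

section \<open>Test functions that are radial for the Euclidean norm\<close>

lemma ln_le_iff_le_exp: "0 < x \<Longrightarrow> ln x \<le> y \<longleftrightarrow> x \<le> exp (y :: real)"
  by (metis exp_gt_zero ln_exp ln_le_cancel_iff)

lemma ln_less_iff_less_exp: "0 < x \<Longrightarrow> ln x < y \<longleftrightarrow> x < exp (y :: real)"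
  by (metis exp_gt_zero ln_exp ln_less_cancel_iff)

text \<open>The function g(ln |x|) is written as G(x \<bullet> x), using ln |x| = ln (x \<bullet> x)
  / 2. Its gradient is a multiple of x, so pairing it with x loses nothing; the last clause keeps
  this fact for the Euclidean part of the theorem.\<close>

lemma radial_test_function:
  fixes g :: "real \<Rightarrow> real" and U :: "(real ^ 'n) set"
  assumes g: "\<And>k. smooth_upto k UNIV g" "\<And>t. t \<notin> {t1..t2} \<Longrightarrow> g t = 0"
    and U: "\<And>x. exp t1 \<le> norm x \<Longrightarrow> norm x \<le> exp t2 \<Longrightarrow> x \<in> U"
  obtains f :: "real ^ 'n \<Rightarrow> complex" where "f \<in> test_functions U"
    "\<And>x. x \<noteq> 0 \<Longrightarrow> norm (f x) = \<bar>g (ln (norm x))\<bar>"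
    "\<And>x. x \<noteq> 0 \<Longrightarrow> norm (real_dot x (grad f x)) = \<bar>deriv g (ln (norm x))\<bar>"
    "\<And>x. norm (real_dot x (grad f x)) = norm x * norm (grad f x)"
proof
  define G where "G r = (if 0 < r then g (ln r / 2) else 0)" for r
  define f :: "real ^ 'n \<Rightarrow> complex" where "f x = of_real (G (x \<bullet> x))" for x
  have half: "ln (x \<bullet> x) / 2 = ln (norm x)" if "x \<noteq> 0" for x :: "real ^ 'n"
    using that by (simp add: dot_square_norm ln_realpow)
  have G_smooth: "smooth_upto k UNIV G" for k
  \<comment> \<open>G vanishes for r < e^(2 t1), an open half-line that contains 0 and overlaps r >
    0.\<close>
  proof (rule smooth_upto_UNIV_split[of "{0<..}" "{..<exp (2 * t1)}"])
    have o: "open {(0::real)<..}" by simp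
    have 1: "smooth_upto k {0<..} (\<lambda>r. ln r * (1 / 2))"
      by (rule smooth_upto_mult[OF o smooth_upto_ln smooth_upto_const[OF o]])
    show "smooth_upto k {0<..} G"
      by (rule smooth_upto_cong[OF o _ smooth_upto_compose[OF o UNIV_I g(1) 1]]) (simp add: G_def)
    show "smooth_upto k {..<exp (2 * t1)} G"
    proof (rule smooth_upto_cong[OF _ _ smooth_upto_const[of _ _ 0]])
      fix r assume "r \<in> {..<exp (2 * t1)}"
      then have "ln r < 2 * t1" if "0 < r"
        using that by (simp add: ln_less_iff_less_exp)
      then show "G r = 0" by (auto simp: G_def intro!: g(2))
    qed auto
    have "0 < exp (2 * t1)" by simp
    then show "{0<..} \<union> {..<exp (2 * t1)} = UNIV"
      by (auto simp del: exp_gt_zero)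
  qed
  have dG: "(G has_field_derivative deriv G r) (at r)" for r
    using smooth_upto_DERIV[OF G_smooth UNIV_I] .
  have derivG: "deriv G r = deriv g (ln r / 2) / (2 * r)" if "0 < r" for r
  proof (rule DERIV_imp_deriv)
    have "((\<lambda>r. ln r / 2) has_field_derivative 1 / (2 * r)) (at r)"
      using that by (auto intro!: derivative_eq_intros simp: field_simps)
    from DERIV_chain2[OF smooth_upto_DERIV[OF g(1) UNIV_I] this]
    have "((\<lambda>r. g (ln r / 2)) has_field_derivative deriv g (ln r / 2) / (2 * r)) (at r)"
      by simp
    then show "(G has_field_derivative deriv g (ln r / 2) / (2 * r)) (at r)"
      by (rule has_field_derivative_transform_within_open[of _ _ _ "{0<..}"])
        (use that in \<open>auto simp: G_def\<close>)
  qed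
  have "(f has_derivative (\<lambda>v. of_real (deriv G (x \<bullet> x) * (2 * (x \<bullet> v))))) (at x)" for x
    using has_derivative_of_real[OF has_derivative_real_of_inner_self[OF dG]] by (simp add: f_def[abs_def])
  note fd = frechet_derivative_at[OF this, symmetric]
  have grad: "grad f x = (\<chi> i. of_real (2 * deriv G (x \<bullet> x) * x $ i))" for x
    by (simp add: grad_def fd inner_axis mult_ac)
  have norm_grad: "norm (grad f x) = \<bar>2 * deriv G (x \<bullet> x)\<bar> * norm x" for x
    unfolding grad norm_vec_def by (simp add: norm_mult abs_mult L2_set_right_distrib)
  have "real_dot x (grad f x) = of_real (2 * deriv G (x \<bullet> x) * (x \<bullet> x))" for x
  proof -
    have "real_dot x (grad f x) = (\<Sum>i\<in>UNIV. of_real (2 * deriv G (x \<bullet> x) * (x $ i * x $ i)))"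
      by (simp add: grad real_dot_def scaleR_conv_of_real mult_ac)
    also have "\<dots> = of_real (2 * deriv G (x \<bullet> x) * (\<Sum>i\<in>UNIV. x $ i * x $ i))"
      by (simp only: of_real_sum sum_distrib_left)
    finally show ?thesis by (simp add: inner_vec_def)
  qed
  then have dot: "norm (real_dot x (grad f x)) = \<bar>2 * deriv G (x \<bullet> x) * (x \<bullet> x)\<bar>" for x
    by (simp only: norm_of_real)
  show "norm (real_dot x (grad f x)) = norm x * norm (grad f x)" for x
    by (simp add: dot norm_grad abs_mult dot_square_norm power2_eq_square)
  show "norm (f x) = \<bar>g (ln (norm x))\<bar>" if "x \<noteq> 0" for x
    using that by (simp add: f_def G_def half)
  show "norm (real_dot x (grad f x)) = \<bar>deriv g (ln (norm x))\<bar>" if "x \<noteq> 0" for x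
    using that by (simp add: dot derivG half)
  let ?K = "cball (0 :: real ^ 'n) (exp t2) - ball 0 (exp t1)"
  have K: "compact ?K" by (intro compact_diff) auto
  have "support_on UNIV f \<subseteq> ?K"
  proof
    fix x assume "x \<in> support_on UNIV f"
    then have fx: "f x \<noteq> 0" by (simp add: in_support_on)
    have x: "x \<noteq> 0" using fx by (auto simp: f_def G_def)
    then have "ln (norm x) \<in> {t1..t2}"
      using fx g(2)[of "ln (norm x)"] by (auto simp: f_def G_def half split: if_splits)
    then show "x \<in> ?K"
      using x ln_ge_iff[of "norm x" t1] ln_le_iff_le_exp[of "norm x" t2] by auto
  qed
  then have sub: "closure (support_on UNIV f) \<subseteq> ?K"
    using compact_imp_closed[OF K] by (rule closure_minimal)
  then have "compact (closure (support_on UNIV f))"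
    using compact_closure bounded_subset[OF compact_imp_bounded[OF K]] closure_subset
    by (meson order_trans)
  moreover have "smooth f"
    unfolding smooth_def f_def by (rule allI) (rule continuously_differentiable_radial[OF G_smooth])
  moreover have "?K \<subseteq> U" using U by auto
  ultimately show "f \<in> test_functions U"
    using sub by (auto simp: test_functions_def)
qed

text \<open>The term b' / M disappears as M = k + 1 grows, under the integrable majorant (|b| +
  |b'|)^N.\<close>

lemma bump_energy_limit:
  fixes b :: "real \<Rightarrow> real"
  assumes b: "\<And>k. smooth_upto k UNIV b" "\<And>x. x \<notin> {0..1} \<Longrightarrow> b x = 0"
    "\<And>x. x \<notin> {0..1} \<Longrightarrow> deriv b x = 0" and N: "0 < N"
  shows "(\<lambda>k. \<integral>x. \<bar>b x / real N - deriv b x / real (Suc k)\<bar> ^ N \<partial>lborel)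
    \<longlonglongrightarrow> (\<integral>x. \<bar>b x / real N\<bar> ^ N \<partial>lborel)"
    and "integrable lborel (\<lambda>x. \<bar>b x / real N - deriv b x / d\<bar> ^ N)"
    and "b \<in> borel_measurable borel" and "deriv b \<in> borel_measurable borel"
proof -
  have "smooth_upto (Suc 0) UNIV (deriv b)" using b(1)[of "Suc (Suc 0)"] by simp
  then have c: "continuous_on UNIV b" "continuous_on UNIV (deriv b)"
    using smooth_upto_DERIV[OF b(1) UNIV_I] smooth_upto_DERIV[of 0 UNIV "deriv b", OF _ UNIV_I]
    by (metis DERIV_isCont continuous_at_imp_continuous_on)+
  then show m [measurable]: "b \<in> borel_measurable borel" "deriv b \<in> borel_measurable borel"
    by (auto intro: borel_measurable_continuous_onI)
  have c': "continuous_on {0..1} b" "continuous_on {0..1} (deriv b)"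
    using c continuous_on_subset by blast+
  have B: "\<bar>b x / real N - deriv b x / real (Suc k)\<bar> ^ N \<le> (\<bar>b x\<bar> + \<bar>deriv b x\<bar>) ^ N" for x k
  proof (rule power_mono)
    have "\<bar>b x / real N\<bar> \<le> \<bar>b x\<bar>" "\<bar>deriv b x / real (Suc k)\<bar> \<le> \<bar>deriv b x\<bar>"
      using N by (auto simp: divide_le_eq mult_le_cancel_left1)
    then show "\<bar>b x / real N - deriv b x / real (Suc k)\<bar> \<le> \<bar>b x\<bar> + \<bar>deriv b x\<bar>" by linarith
  qed simp
  have "integrable lborel (\<lambda>x. (\<bar>b x\<bar> + \<bar>deriv b x\<bar>) ^ N)"
    by (rule integrable_continuous_compact_support[of "{0..1}"])
      (use b N in \<open>auto intro!: continuous_intros c'\<close>)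
  moreover have "(\<lambda>k. \<bar>b x / real N - deriv b x / real (Suc k)\<bar> ^ N) \<longlonglongrightarrow> \<bar>b x / real N - 0\<bar> ^ N" for x
  proof (intro tendsto_intros)
    show "(\<lambda>k. deriv b x / real (Suc k)) \<longlonglongrightarrow> 0"
      using tendsto_mult_right_zero[OF LIMSEQ_inverse_real_of_nat, of "deriv b x"]
      by (simp add: divide_inverse)
  qed
  ultimately show "(\<lambda>k. \<integral>x. \<bar>b x / real N - deriv b x / real (Suc k)\<bar> ^ N \<partial>lborel)
    \<longlonglongrightarrow> (\<integral>x. \<bar>b x / real N\<bar> ^ N \<partial>lborel)"
    using B by (intro integral_dominated_convergence[where w = "\<lambda>x. (\<bar>b x\<bar> + \<bar>deriv b x\<bar>) ^ N"]) auto
  show "integrable lborel (\<lambda>x. \<bar>b x / real N - deriv b x / d\<bar> ^ N)"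
    by (rule integrable_continuous_compact_support[of "{0..1}"])
      (use b N in \<open>auto intro!: continuous_intros c' simp: divide_inverse\<close>)
qed

text \<open>By homogeneity the difference depends only on x / |x|, and ln q is continuous on the
  compact unit sphere.\<close>

lemma quasinorm_log_bound:
  fixes q :: "real ^ 'n \<Rightarrow> real"
  assumes q: "homogeneous_quasinorm q"
  obtains \<Phi> where "\<And>x. x \<noteq> 0 \<Longrightarrow> \<bar>ln (q x) - ln (norm x)\<bar> \<le> \<Phi>"
proof -
  have qc: "continuous_on UNIV q" and q0: "\<And>x. 0 \<le> q x" and qz: "\<And>x. q x = 0 \<longleftrightarrow> x = 0"
    and qh: "\<And>x l. 0 < l \<Longrightarrow> q (l *\<^sub>R x) = l * q x"
    using q by (auto simp: homogeneous_quasinorm_def)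
  have "continuous_on (sphere 0 1) (\<lambda>x. ln (q x))"
    by (intro continuous_on_ln continuous_on_subset[OF qc]) (auto simp: qz)
  from compact_imp_bounded[OF compact_continuous_image[OF this compact_sphere]]
  obtain \<Phi> where \<Phi>: "\<forall>y\<in>(\<lambda>x. ln (q x)) ` sphere 0 1. norm y \<le> \<Phi>"
    unfolding bounded_iff by (elim exE)
  show ?thesis
  proof (rule that)
    fix x :: "real ^ 'n" assume x: "x \<noteq> 0"
    let ?u = "x /\<^sub>R norm x"
    have u: "?u \<in> sphere 0 1" using x by simp
    then have "0 < q ?u" using q0[of ?u] qz[of ?u] x by auto
    moreover have "q x = norm x * q ?u"
      using qh[of "norm x" ?u] x by simp
    ultimately have "ln (q x) - ln (norm x) = ln (q ?u)" using x by (simp add: ln_mult)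
    then show "\<bar>ln (q x) - ln (norm x)\<bar> \<le> \<Phi>" using \<Phi> u by force
  qed
qed

text \<open>Replacing ln q by ln |x| costs a factor 1 + \<theta>, and the cutoff costs b' / M.
  Together these losses are kept below the gap between C and N. The choice of M does not involve T,
  so T can be taken as large as the first loss requires.\<close>

lemma near_extremal:
  fixes q :: "real ^ 'n \<Rightarrow> real"
  defines "N \<equiv> CARD('n)"
  assumes q: "homogeneous_quasinorm q" and R: "0 < R" and C: "0 \<le> C" "C < real N"
  shows "\<exists>f\<in>test_functions (quasi_ball q R - {0}). \<exists>I J. 0 \<le> I \<and> 0 \<le> J \<and> C ^ N * J < I \<and>
    (\<integral>\<^sup>+x. ennreal (norm (f x) ^ N / q x ^ N) \<partial>lborel) = ennreal I \<and>
    (\<integral>\<^sup>+x. ennreal ((\<bar>ln (q x)\<bar> * norm (real_dot x (grad f x))) ^ N / q x ^ N) \<partial>lborel) = ennreal J \<and>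
    (\<forall>x. norm (real_dot x (grad f x)) = norm x * norm (grad f x))"
proof -
  have N: "0 < N" by (simp add: N_def)
  have q0: "\<And>x. 0 \<le> q x" and qz: "\<And>x. q x = 0 \<longleftrightarrow> x = 0"
    using q by (auto simp: homogeneous_quasinorm_def)
  obtain \<Phi> where \<Phi>: "\<And>x. x \<noteq> 0 \<Longrightarrow> \<bar>ln (q x) - ln (norm x)\<bar> \<le> \<Phi>"
    using quasinorm_log_bound[OF q] by blast
  obtain b where b: "\<And>k. smooth_upto k UNIV b" "\<And>x. 0 \<le> b x" "\<And>x. 0 < b x \<longleftrightarrow> 0 < x \<and> x < 1"
    "\<And>x. x \<notin> {0..1} \<Longrightarrow> deriv b x = 0"
    using exists_smooth_bump by metis
  have b0: "b x = 0" if "x \<notin> {0..1}" for x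
    using b(2,3)[of x] that by auto
  note lim = bump_energy_limit[OF b(1) b0 b(4) N]
  note [measurable] = lim(3,4)
  \<comment> \<open>Half of the relative gap: C (1 + \<theta>) \<le> C + (N - C) / 2 < N.\<close>
  define \<theta> where "\<theta> = (real N - C) / (2 * real N)"
  have \<theta>: "0 < \<theta>" using C N by (simp add: \<theta>_def)
  have "C * (1 + \<theta>) < real N"
  proof -
    have "C * \<theta> \<le> real N * \<theta>" using C \<theta> by (intro mult_right_mono) auto
    also have "\<dots> = (real N - C) / 2" using N by (simp add: \<theta>_def)
    finally show ?thesis using C by (simp add: algebra_simps)
  qed
  then have \<theta>N: "(C * (1 + \<theta>)) ^ N < real N ^ N"
    using C \<theta> N by (intro power_strict_mono) auto
  define X where "X = (\<integral>x. b x ^ N \<partial>lborel)"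
  define Y where "Y k = (\<integral>x. \<bar>b x / real N - deriv b x / real (Suc k)\<bar> ^ N \<partial>lborel)" for k
  have X: "(\<integral>\<^sup>+x. ennreal (b x ^ N) \<partial>lborel) = ennreal X"
  proof -
    \<comment> \<open>Division by 0 yields 0, so taking d = 0 removes the term with
      \<open>deriv b\<close>.\<close>
    have "integrable lborel (\<lambda>x. real N ^ N * \<bar>b x / real N - deriv b x / 0\<bar> ^ N)"
      using lim(2)[of 0] by (rule integrable_mult_right)
    then have "integrable lborel (\<lambda>x. b x ^ N)"
      using N b(2) by (simp add: power_divide)
    then show ?thesis unfolding X_def by (rule nn_integral_eq_integral) (simp add: b(2))
  qed
  have "0 < (\<integral>\<^sup>+x. ennreal (b x ^ N) \<partial>lborel)"
    by (rule nn_integral_pos_on_open[of _ "{0<..<1}"]) (auto simp: b(3))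
  then have X0: "0 < X" by (simp add: X)
  have Y: "(\<integral>\<^sup>+x. ennreal (\<bar>b x / real N - deriv b x / real (Suc k)\<bar> ^ N) \<partial>lborel) = ennreal (Y k)" for k
    unfolding Y_def by (rule nn_integral_eq_integral[OF lim(2)]) (auto intro!: AE_I2)
  have Y0: "0 \<le> Y k" for k
    unfolding Y_def by (intro Bochner_Integration.integral_nonneg zero_le_power abs_ge_zero)
  have "(\<integral>x. \<bar>b x / real N\<bar> ^ N \<partial>lborel) = X / real N ^ N"
    using b(2) by (simp add: X_def power_divide)
  with lim(1) have "Y \<longlonglongrightarrow> X / real N ^ N" by (simp add: Y_def[abs_def])
  then have "(\<lambda>k. (C * (1 + \<theta>)) ^ N * Y k) \<longlonglongrightarrow> (C * (1 + \<theta>)) ^ N * (X / real N ^ N)"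
    by (intro tendsto_intros)
  moreover have "(C * (1 + \<theta>)) ^ N * (X / real N ^ N) < X"
    using \<theta>N X0 N by (simp add: field_simps)
  ultimately have "\<forall>\<^sub>F k in sequentially. (C * (1 + \<theta>)) ^ N * Y k < X"
    by (rule order_tendstoD)
  then obtain k where k: "(C * (1 + \<theta>)) ^ N * Y k < X"
    by (auto simp: eventually_sequentially)
  define M where "M = real (Suc k)"
  \<comment> \<open>The entry 1 makes T positive; \<open>\<Phi> / \<theta>\<close> makes the error
    \<Phi> at most \<theta> |ln |x|| on the support; the last entry puts the support into the
    quasi-ball, since there ln q \<le> \<Phi> - T < ln R.\<close>
  define T where "T = max 1 (max (\<Phi> / \<theta>) (\<Phi> - ln R + 1))"
  have "\<Phi> / \<theta> \<le> T" "\<Phi> - ln R + 1 \<le> T" "1 \<le> T" by (simp_all add: T_def)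
  then have T: "0 < T" "\<Phi> \<le> \<theta> * T" "\<Phi> - T < ln R"
    using \<theta> by (simp_all add: pos_divide_le_eq mult.commute)
  have M: "0 < M" by (simp add: M_def)
  define g where "g = log_profile b N T M"
  note prof = b(1-3) N T(1) M
  have gs: "smooth_upto k UNIV g" for k
    unfolding g_def by (rule smooth_log_profile[OF prof])
  have g0: "g t = 0" if "t \<notin> {- (T * exp M)..- T}" for t
    unfolding g_def by (rule log_profile_eq_0[OF prof that])
  have inU: "x \<in> quasi_ball q R - {0}" if "exp (- (T * exp M)) \<le> norm x" "norm x \<le> exp (- T)" for x
  proof -
    have "0 < exp (- (T * exp M))" by simp
    then have x: "x \<noteq> 0" using that(1) by auto
    then have "ln (norm x) \<le> - T" using that(2) by (simp add: ln_le_iff_le_exp)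
    then have "ln (q x) < ln R" using \<Phi>[OF x] T(3) by linarith
    then have "q x < R" using R x q0[of x] qz[of x] by (subst (asm) ln_less_cancel_iff) auto
    then show ?thesis using x by (simp add: quasi_ball_def)
  qed
  obtain f :: "real ^ 'n \<Rightarrow> complex" where f: "f \<in> test_functions (quasi_ball q R - {0})"
    "\<And>x. x \<noteq> 0 \<Longrightarrow> norm (f x) = \<bar>g (ln (norm x))\<bar>"
    "\<And>x. x \<noteq> 0 \<Longrightarrow> norm (real_dot x (grad f x)) = \<bar>deriv g (ln (norm x))\<bar>"
    "\<And>x. norm (real_dot x (grad f x)) = norm x * norm (grad f x)"
    by (rule radial_test_function[of g "- (T * exp M)" "- T" "quasi_ball q R - {0}"])
      (rule gs, erule g0, erule (1) inU, blast)
  from exists_quasinorm_constant[OF q, folded N_def]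
  obtain c where c: "0 < c" "\<forall>h\<in>borel_measurable borel.
      (\<integral>\<^sup>+x. h (ln (norm x)) * ennreal (1 / q x ^ N) \<partial>lborel) = ennreal c * (\<integral>\<^sup>+t. h t \<partial>lborel)"
    by (elim exE conjE)
  from exists_halfline_constant
  obtain c' where c': "0 < c'" "\<forall>h\<in>borel_measurable borel.
      (\<integral>\<^sup>+t. h (ln \<bar>t\<bar>) * ennreal (if t < 0 then 1 / (- t) else 0) \<partial>lborel)
        = ennreal c' * (\<integral>\<^sup>+u. h u \<partial>(lborel :: real measure))"
    by (elim exE conjE)
  \<comment> \<open>Two substitutions in a row: u = ln |t|, then translation by ln T and scaling by
    M.\<close>
  have line: "(\<integral>\<^sup>+t. ennreal (\<psi> ((ln \<bar>t\<bar> - ln T) / M) * (if t < 0 then 1 / (- t) else 0)) \<partial>lborel)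
      = ennreal (c' * M) * (\<integral>\<^sup>+u. ennreal (\<psi> u) \<partial>lborel)"
    if [measurable]: "\<psi> \<in> borel_measurable borel" and "\<And>u. 0 \<le> \<psi> u" for \<psi> :: "real \<Rightarrow> real"
  proof -
    have "(\<integral>\<^sup>+t. ennreal (\<psi> ((ln \<bar>t\<bar> - ln T) / M) * (if t < 0 then 1 / (- t) else 0)) \<partial>lborel)
      = (\<integral>\<^sup>+t. ennreal (\<psi> ((ln \<bar>t\<bar> - ln T) / M)) * ennreal (if t < 0 then 1 / (- t) else 0) \<partial>lborel)"
      using that(2) by (intro nn_integral_cong) (simp add: ennreal_mult')
    also have "\<dots> = ennreal c' * (\<integral>\<^sup>+u. ennreal (\<psi> ((u - ln T) / M)) \<partial>lborel)"
      by (rule bspec[OF c'(2)]) measurable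
    also have "(\<integral>\<^sup>+u. ennreal (\<psi> ((u - ln T) / M)) \<partial>lborel) = ennreal M * (\<integral>\<^sup>+u. ennreal (\<psi> u) \<partial>lborel)"
      using M by (subst nn_integral_real_affine[of _ M "ln T"]) auto
    finally show ?thesis using c'(1) M by (simp add: ennreal_mult mult.assoc)
  qed
  have gm [measurable]: "g \<in> borel_measurable borel" "deriv g \<in> borel_measurable borel"
  proof -
    have "smooth_upto (Suc 0) UNIV (deriv g)" using gs[of "Suc (Suc 0)"] by simp
    then have "continuous_on UNIV g" "continuous_on UNIV (deriv g)"
      using smooth_upto_DERIV[OF gs UNIV_I] smooth_upto_DERIV[of 0 UNIV "deriv g", OF _ UNIV_I]
      by (metis DERIV_isCont continuous_at_imp_continuous_on)+
    then show "g \<in> borel_measurable borel" "deriv g \<in> borel_measurable borel"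
      by (auto intro: borel_measurable_continuous_onI)
  qed
  \<comment> \<open>The first integral is computed exactly, the second only bounded above by
    \<open>J'\<close>. The factor c c' M is common to both and cancels in the comparison.\<close>
  define I where "I = c * (c' * M * X)"
  define J' where "J' = (1 + \<theta>) ^ N * (c * (c' * M * Y k))"
  have I: "(\<integral>\<^sup>+x. ennreal (norm (f x) ^ N / q x ^ N) \<partial>lborel) = ennreal I"
  proof -
    have "(\<integral>\<^sup>+x. ennreal (norm (f x) ^ N / q x ^ N) \<partial>lborel)
      = (\<integral>\<^sup>+x. ennreal (\<bar>g (ln (norm x))\<bar> ^ N) * ennreal (1 / q x ^ N) \<partial>lborel)"
    proof (rule nn_integral_cong)
      fix x
      show "ennreal (norm (f x) ^ N / q x ^ N) = ennreal (\<bar>g (ln (norm x))\<bar> ^ N) * ennreal (1 / q x ^ N)"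
        using f(2)[of x] qz[of x] q0[of x] N by (cases "x = 0") (auto simp flip: ennreal_mult')
    qed
    also have "\<dots> = ennreal c * (\<integral>\<^sup>+t. ennreal (\<bar>g t\<bar> ^ N) \<partial>lborel)"
      by (rule bspec[OF c(2)]) measurable
    also have "(\<integral>\<^sup>+t. ennreal (\<bar>g t\<bar> ^ N) \<partial>lborel) = ennreal (c' * M) * ennreal X"
      unfolding g_def abs_log_profile_power[OF prof] using line[of "\<lambda>u. b u ^ N"] b(2) by (simp add: X)
    finally show ?thesis
      using c(1) c'(1) M X0 by (simp add: I_def ennreal_mult)
  qed
  let ?J = "\<integral>\<^sup>+x. ennreal ((\<bar>ln (q x)\<bar> * norm (real_dot x (grad f x))) ^ N / q x ^ N) \<partial>lborel"
  have "?J \<le> (\<integral>\<^sup>+x. ennreal ((1 + \<theta>) ^ N * (\<bar>ln (norm x)\<bar> * \<bar>deriv g (ln (norm x))\<bar>) ^ N)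
      * ennreal (1 / q x ^ N) \<partial>lborel)"
  proof (rule nn_integral_mono)
    fix x
    show "ennreal ((\<bar>ln (q x)\<bar> * norm (real_dot x (grad f x))) ^ N / q x ^ N)
      \<le> ennreal ((1 + \<theta>) ^ N * (\<bar>ln (norm x)\<bar> * \<bar>deriv g (ln (norm x))\<bar>) ^ N) * ennreal (1 / q x ^ N)"
    proof (cases "x = 0")
      case True
      then show ?thesis using N qz[of 0] by simp
    next
      case False
      \<comment> \<open>Either g' vanishes at ln |x|, or ln |x| \<le> -T and \<Phi> is absorbed into
        \<theta> |ln |x||.\<close>
      have "\<bar>ln (q x)\<bar> * \<bar>deriv g (ln (norm x))\<bar> \<le> (1 + \<theta>) * (\<bar>ln (norm x)\<bar> * \<bar>deriv g (ln (norm x))\<bar>)"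
      proof (cases "- T < ln (norm x)")
        case True
        then show ?thesis using deriv_log_profile_eq_0[OF prof True] by (simp add: g_def)
      next
        case False
        then have t: "T \<le> \<bar>ln (norm x)\<bar>" by linarith
        have "\<bar>ln (q x)\<bar> \<le> \<bar>ln (norm x)\<bar> + \<Phi>" using \<Phi>[OF \<open>x \<noteq> 0\<close>] by linarith
        also have "\<Phi> \<le> \<theta> * \<bar>ln (norm x)\<bar>"
          using T(2) mult_left_mono[OF t, of \<theta>] \<theta> by linarith
        finally have "\<bar>ln (q x)\<bar> \<le> (1 + \<theta>) * \<bar>ln (norm x)\<bar>" by (simp add: algebra_simps)
        from mult_right_mono[OF this, of "\<bar>deriv g (ln (norm x))\<bar>"]
        show ?thesis by (simp add: mult.assoc)
      qed
      then have "(\<bar>ln (q x)\<bar> * norm (real_dot x (grad f x))) ^ N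
          \<le> ((1 + \<theta>) * (\<bar>ln (norm x)\<bar> * \<bar>deriv g (ln (norm x))\<bar>)) ^ N"
        unfolding f(3)[OF False] by (rule power_mono) simp
      then have "(\<bar>ln (q x)\<bar> * norm (real_dot x (grad f x))) ^ N / q x ^ N
          \<le> (1 + \<theta>) ^ N * (\<bar>ln (norm x)\<bar> * \<bar>deriv g (ln (norm x))\<bar>) ^ N * (1 / q x ^ N)"
        using q0[of x] by (simp add: power_mult_distrib divide_right_mono)
      then show ?thesis
        using q0[of x] \<theta> by (subst ennreal_mult'[symmetric]) (auto intro!: ennreal_leI)
    qed
  qed
  also have "\<dots> = ennreal c * (\<integral>\<^sup>+t. ennreal ((1 + \<theta>) ^ N * (\<bar>t\<bar> * \<bar>deriv g t\<bar>) ^ N) \<partial>lborel)"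
    by (rule bspec[OF c(2)]) measurable
  also have "(\<integral>\<^sup>+t. ennreal ((1 + \<theta>) ^ N * (\<bar>t\<bar> * \<bar>deriv g t\<bar>) ^ N) \<partial>lborel)
      = ennreal ((1 + \<theta>) ^ N) * (\<integral>\<^sup>+t. ennreal ((\<bar>t\<bar> * \<bar>deriv g t\<bar>) ^ N) \<partial>lborel)"
    using \<theta> by (subst nn_integral_cmult[symmetric]) (auto simp: ennreal_mult')
  also have "(\<integral>\<^sup>+t. ennreal ((\<bar>t\<bar> * \<bar>deriv g t\<bar>) ^ N) \<partial>lborel) = ennreal (c' * M) * ennreal (Y k)"
    unfolding g_def abs_deriv_log_profile_power[OF prof]
    using line[of "\<lambda>u. \<bar>b u / real N - deriv b u / M\<bar> ^ N"] Y[of k] by (simp add: M_def)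
  finally have J': "?J \<le> ennreal J'"
    using c(1) c'(1) M Y0[of k] \<theta> by (simp add: J'_def ennreal_mult mult_ac)
  then obtain J where J: "?J = ennreal J" "0 \<le> J" by (cases ?J) (auto simp: top_unique)
  have "0 \<le> J'" using c(1) c'(1) M Y0[of k] \<theta> by (simp add: J'_def)
  then have "J \<le> J'" using J' J by simp
  then have "C ^ N * J \<le> C ^ N * J'" using C by (intro mult_left_mono) auto
  also have "\<dots> = (c * (c' * M)) * ((C * (1 + \<theta>)) ^ N * Y k)"
    by (simp add: J'_def power_mult_distrib mult_ac)
  also have "\<dots> < (c * (c' * M)) * X"
    using k c(1) c'(1) M by (intro mult_strict_left_mono) auto
  finally have "C ^ N * J < I" by (simp add: I_def mult_ac)
  moreover have "0 \<le> I" using c(1) c'(1) M X0 by (simp add: I_def)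
  ultimately show ?thesis using f(1,4) I J by blast
qed

text \<open>Restates \<open>near_extremal\<close> for norms. The general B and the clause on the
  full gradient allow the same f to refute a smaller constant in the Euclidean inequality on the
  whole space.\<close>

lemma quasinorm_hardy_sharp:
  fixes q :: "real ^ 'n \<Rightarrow> real"
  defines "n \<equiv> real CARD('n)"
  assumes q: "homogeneous_quasinorm q" and R: "0 < R" and C: "0 \<le> C" "C < n"
    and B: "quasi_ball q R - {0} \<subseteq> B"
  shows "\<exists>f\<in>test_functions (quasi_ball q R - {0}).
    \<not> Lp_norm n B (\<lambda>x. f x /\<^sub>R q x)
      \<le> ennreal C * Lp_norm n B (\<lambda>x. ln (q x) *\<^sub>R real_dot (x /\<^sub>R q x) (grad f x)) \<and>
    (\<forall>x. norm (real_dot x (grad f x)) = norm x * norm (grad f x))"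
proof -
  from near_extremal[OF q R C[unfolded n_def]]
  obtain f I J where f: "f \<in> test_functions (quasi_ball q R - {0})" and I: "0 \<le> I" and J: "0 \<le> J"
    and less: "C ^ CARD('n) * J < I"
    and fI: "(\<integral>\<^sup>+x. ennreal (norm (f x) ^ CARD('n) / q x ^ CARD('n)) \<partial>lborel) = ennreal I"
    and fJ: "(\<integral>\<^sup>+x. ennreal ((\<bar>ln (q x)\<bar> * norm (real_dot x (grad f x))) ^ CARD('n) / q x ^ CARD('n)) \<partial>lborel)
      = ennreal J"
    and rad: "\<forall>x. norm (real_dot x (grad f x)) = norm x * norm (grad f x)"
    by (elim bexE exE conjE)
  note Q = quasinorm_integrals[OF q f B, folded n_def, unfolded fI fJ]
  have n: "0 < n" by (simp add: n_def)
  have "\<not> Lp_norm n B (\<lambda>x. f x /\<^sub>R q x)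
      \<le> ennreal C * Lp_norm n B (\<lambda>x. ln (q x) *\<^sub>R real_dot (x /\<^sub>R q x) (grad f x))"
    unfolding Lp_norm_le_mult_iff[OF n C(1) Q(1) I Q(2) J]
    using less C(1) by (simp add: n_def powr_realpow')
  with f rad show ?thesis by blast
qed

theorem mainTheorem4:
  fixes n :: real
  defines "n \<equiv> real CARD('n::finite)"
  shows
    "(\<forall>(q :: real ^ 'n \<Rightarrow> real) R. homogeneous_quasinorm q \<and> 0 < R \<longrightarrow>
        (\<forall>f \<in> test_functions (quasi_ball q R - {0}).
           Lp_norm n (quasi_ball q R) (\<lambda>x. f x /\<^sub>R q x)
           \<le> ennreal n * Lp_norm n (quasi_ball q R)
               (\<lambda>x. ln (q x) *\<^sub>R real_dot (x /\<^sub>R q x) (grad f x))) \<and>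
        \<not> (\<exists>C. 0 \<le> C \<and> C < n \<and>
           (\<forall>f \<in> test_functions (quasi_ball q R - {0}).
              Lp_norm n (quasi_ball q R) (\<lambda>x. f x /\<^sub>R q x)
              \<le> ennreal C * Lp_norm n (quasi_ball q R)
                  (\<lambda>x. ln (q x) *\<^sub>R real_dot (x /\<^sub>R q x) (grad f x)))))
     \<and>
     (\<forall>f \<in> test_functions (UNIV - {0 :: real ^ 'n}).
        Lp_norm n UNIV (\<lambda>x. f x /\<^sub>R norm x)
        \<le> ennreal n * Lp_norm n UNIV (\<lambda>x. ln (norm x) *\<^sub>R grad f x)) \<and>
     \<not> (\<exists>C. 0 \<le> C \<and> C < n \<and>
        (\<forall>f \<in> test_functions (UNIV - {0 :: real ^ 'n}).
           Lp_norm n UNIV (\<lambda>x. f x /\<^sub>R norm x)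
           \<le> ennreal C * Lp_norm n UNIV (\<lambda>x. ln (norm x) *\<^sub>R grad f x)))"
proof (intro conjI allI impI ballI)
  fix q :: "real ^ 'n \<Rightarrow> real" and R :: real and f
  assume "homogeneous_quasinorm q \<and> 0 < R" and "f \<in> test_functions (quasi_ball q R - {0})"
  then show "Lp_norm n (quasi_ball q R) (\<lambda>x. f x /\<^sub>R q x)
      \<le> ennreal n * Lp_norm n (quasi_ball q R)
          (\<lambda>x. ln (q x) *\<^sub>R real_dot (x /\<^sub>R q x) (grad f x))"
    unfolding n_def by (intro quasinorm_hardy[of q f "quasi_ball q R - {0}"]) auto
next
  fix q :: "real ^ 'n \<Rightarrow> real" and R :: real
  assume "homogeneous_quasinorm q \<and> 0 < R"
  then show "\<not> (\<exists>C. 0 \<le> C \<and> C < n \<and>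
      (\<forall>f \<in> test_functions (quasi_ball q R - {0}).
         Lp_norm n (quasi_ball q R) (\<lambda>x. f x /\<^sub>R q x)
         \<le> ennreal C * Lp_norm n (quasi_ball q R)
             (\<lambda>x. ln (q x) *\<^sub>R real_dot (x /\<^sub>R q x) (grad f x))))"
    using quasinorm_hardy_sharp[of q R _ "quasi_ball q R"] unfolding n_def by fast
next
  fix f :: "real ^ 'n \<Rightarrow> complex"
  assume "f \<in> test_functions (UNIV - {0})"
  then show "Lp_norm n UNIV (\<lambda>x. f x /\<^sub>R norm x) \<le> ennreal n * Lp_norm n UNIV (\<lambda>x. ln (norm x) *\<^sub>R grad f x)"
    unfolding n_def by (rule euclidean_hardy)
next
  show "\<not> (\<exists>C. 0 \<le> C \<and> C < n \<and>
      (\<forall>f \<in> test_functions (UNIV - {0 :: real ^ 'n}).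
         Lp_norm n UNIV (\<lambda>x. f x /\<^sub>R norm x)
         \<le> ennreal C * Lp_norm n UNIV (\<lambda>x. ln (norm x) *\<^sub>R grad f x)))"
  proof
    assume "\<exists>C. 0 \<le> C \<and> C < n \<and>
      (\<forall>f \<in> test_functions (UNIV - {0 :: real ^ 'n}).
         Lp_norm n UNIV (\<lambda>x. f x /\<^sub>R norm x)
         \<le> ennreal C * Lp_norm n UNIV (\<lambda>x. ln (norm x) *\<^sub>R grad f x))"
    then obtain C where C: "0 \<le> C" "C < n"
      and le: "\<And>f. f \<in> test_functions (UNIV - {0 :: real ^ 'n}) \<Longrightarrow>
         Lp_norm n UNIV (\<lambda>x. f x /\<^sub>R norm x) \<le> ennreal C * Lp_norm n UNIV (\<lambda>x. ln (norm x) *\<^sub>R grad f x)"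
      by blast
    \<comment> \<open>The radius 1 is arbitrary: a test function supported in a punctured ball is
      also one on the punctured space.\<close>
    from quasinorm_hardy_sharp[OF homogeneous_quasinorm_norm zero_less_one C[unfolded n_def] subset_UNIV,
        folded n_def]
    obtain f :: "real ^ 'n \<Rightarrow> complex" where f: "f \<in> test_functions (quasi_ball norm 1 - {0})"
      and no: "\<not> Lp_norm n UNIV (\<lambda>x. f x /\<^sub>R norm x)
        \<le> ennreal C * Lp_norm n UNIV (\<lambda>x. ln (norm x) *\<^sub>R real_dot (x /\<^sub>R norm x) (grad f x))"
      and rad: "\<forall>x. norm (real_dot x (grad f x)) = norm x * norm (grad f x)"
      by (elim bexE conjE)
    \<comment> \<open>For this f Cauchy-Schwarz is an equality, so C would be valid for the radial
      derivative as well, contradicting \<open>no\<close>.\<close>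
    have "Lp_norm n UNIV (\<lambda>x. ln (norm x) *\<^sub>R grad f x)
        \<le> Lp_norm n UNIV (\<lambda>x. ln (norm x) *\<^sub>R real_dot (x /\<^sub>R norm x) (grad f x))"
    proof (rule Lp_norm_mono)
      fix x :: "real ^ 'n"
      show "norm (ln (norm x) *\<^sub>R grad f x) \<le> norm (ln (norm x) *\<^sub>R real_dot (x /\<^sub>R norm x) (grad f x))"
      proof (cases "x = 0")
        case False
        then have "norm (real_dot (x /\<^sub>R norm x) (grad f x)) = norm (grad f x)"
          using rad by (simp add: real_dot_scaleR)
        then show ?thesis by simp
      qed simp
    qed (simp add: n_def)
    then have "ennreal C * Lp_norm n UNIV (\<lambda>x. ln (norm x) *\<^sub>R grad f x)
        \<le> ennreal C * Lp_norm n UNIV (\<lambda>x. ln (norm x) *\<^sub>R real_dot (x /\<^sub>R norm x) (grad f x))"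
      by (rule mult_left_mono) simp
    moreover have "f \<in> test_functions (UNIV - {0})"
      using f by (auto simp: test_functions_def)
    ultimately have "Lp_norm n UNIV (\<lambda>x. f x /\<^sub>R norm x)
        \<le> ennreal C * Lp_norm n UNIV (\<lambda>x. ln (norm x) *\<^sub>R real_dot (x /\<^sub>R norm x) (grad f x))"
      using order_trans[OF le] by blast
    with no show False ..
  qed
qed

end
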